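(* Let $L$ be one of the calculi $\mathrm{gTK}$, $\mathrm{gTKT}$, or $\mathrm{HTS5}$ defined in the context. Then $L$ has the subformula property: if a sequent (for HTS5, a hypersequent) $S$ is provable in $L$, then there is a proof $P$ of $S$ in $L$ such that every formula appearing in $P$ is a subformula of some formula in $S$.
   Context: Formulas are built from countably many propositional variables using the binary connectives $\wedge,\vee,\to$ and the unary connectives $\neg,\Box,\Diamond$; subformulas are defined as usual. Letters $\Gamma,\Delta,\Sigma,\Pi$ (possibly with subscripts) denote finite, possibly empty, sets of formulas; a sequent is an expression $\Gamma\Rightarrow\Delta$; a comma denotes union. For a word $w$ over $\{\neg,\Box,\Diamond\}$, $w\Gamma=\{w\gamma:\gamma\in\Gamma\}$. A rule "$S_1;\dots;S_n\,/\,S$" has premises $S_1,\dots,S_n$ and conclusion $S$. gTK. Initial sequents: for every propositional variable $p$: $p\Rightarrow p$, $\neg p\Rightarrow\neg p$, $\neg p,p\Rightarrow$, $\Rightarrow\neg p,p$. Rules: (cut) $\Gamma\Rightarrow\alpha$; $\alpha,\Gamma\Rightarrow\Delta$ / $\Gamma\Rightarrow\Delta$. (we-left) $\Gamma\Rightarrow\Delta$ / $\alpha,\Gamma\Rightarrow\Delta$. (we-right) $\Gamma\Rightarrow\Delta$ / $\Gamma\Rightarrow\Delta,\alpha$. ($\wedge$left) $\alpha,\beta,\Gamma\Rightarrow\Delta$ / $\alpha\wedge\beta,\Gamma\Rightarrow\Delta$. ($\wedge$right) $\Gamma\Rightarrow\Delta,\alpha$; $\Gamma\Rightarrow\Delta,\beta$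 / $\Gamma\Rightarrow\Delta,\alpha\wedge\beta$. ($\vee$left) $\alpha,\Gamma\Rightarrow\Delta$; $\beta,\Gamma\Rightarrow\Delta$ / $\alpha\vee\beta,\Gamma\Rightarrow\Delta$. ($\vee$right) $\Gamma\Rightarrow\Delta,\alpha,\beta$ / $\Gamma\Rightarrow\Delta,\alpha\vee\beta$. ($\to$left) $\Gamma\Rightarrow\Delta,\alpha$; $\beta,\Gamma\Rightarrow\Delta$ / $\alpha\to\beta,\Gamma\Rightarrow\Delta$. ($\to$right) $\alpha,\Gamma\Rightarrow\Delta,\beta$ / $\Gamma\Rightarrow\Delta,\alpha\to\beta$. ($\neg\neg$left$^t$) $\alpha,\Gamma\Rightarrow\Delta$ / $\neg\neg\alpha,\Gamma\Rightarrow\Delta$. ($\neg\neg$right$^t$) $\Gamma\Rightarrow\Delta,\alpha$ / $\Gamma\Rightarrow\Delta,\neg\neg\alpha$. ($\neg\wedge$left$^t$) $\Gamma\Rightarrow\Delta,\alpha$; $\Gamma\Rightarrow\Delta,\beta$ / $\neg(\alpha\wedge\beta),\Gamma\Rightarrow\Delta$. ($\neg\wedge$right$^t$) $\alpha,\beta,\Gamma\Rightarrow\Delta$ / $\Gamma\Rightarrow\Delta,\neg(\alpha\wedge\beta)$. ($\neg\vee$left$^t$) $\Gamma\Rightarrow\Delta,\alpha,\beta$ / $\neg(\alpha\vee\beta),\Gamma\Rightarrow\Delta$. ($\neg\vee$right$^t$) $\alpha,\Gamma\Rightarrow\Delta$; $\beta,\Gamma\Rightarrow\Delta$ / $\Gamma\Rightarrow\Delta,\neg(\alpha\vee\beta)$.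 ($\neg\to$left$^t$) $\alpha,\Gamma\Rightarrow\Delta,\beta$ / $\neg(\alpha\to\beta),\Gamma\Rightarrow\Delta$. ($\neg\to$right$^t$) $\Gamma\Rightarrow\Delta,\alpha$; $\beta,\Gamma\Rightarrow\Delta$ / $\Gamma\Rightarrow\Delta,\neg(\alpha\to\beta)$. ($\Box$K-right$^T$) $\Gamma_1,\Delta_2\Rightarrow\Delta_1,\Gamma_2,\alpha$ / $\Box\Gamma_1,\neg\Diamond\Gamma_2\Rightarrow\Diamond\Delta_1,\neg\Box\Delta_2,\Box\alpha$. ($\Diamond$K-left$^T$) $\alpha,\Gamma_1,\Delta_2\Rightarrow\Delta_1,\Gamma_2$ / $\Diamond\alpha,\Box\Gamma_1,\neg\Diamond\Gamma_2\Rightarrow\Diamond\Delta_1,\neg\Box\Delta_2$. ($\neg\Box$K-left$^T$) $\Gamma_1,\Delta_2\Rightarrow\Delta_1,\Gamma_2,\alpha$ / $\neg\Box\alpha,\Box\Gamma_1,\neg\Diamond\Gamma_2\Rightarrow\Diamond\Delta_1,\neg\Box\Delta_2$. ($\neg\Diamond$K-right$^T$) $\alpha,\Gamma_1,\Delta_2\Rightarrow\Delta_1,\Gamma_2$ / $\Box\Gamma_1,\neg\Diamond\Gamma_2\Rightarrow\Diamond\Delta_1,\neg\Box\Delta_2,\neg\Diamond\alpha$. gTK has no other rules. gTKT is gTK together with: ($\Box$left) $\alpha,\Gamma\Rightarrow\Delta$ / $\Box\alpha,\Gamma\Rightarrow\Delta$; ($\Diamond$right) $\Gamma\Rightarrow\Delta,\alpha$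 / $\Gamma\Rightarrow\Delta,\Diamond\alpha$; ($\neg\Box$right$^t$) $\alpha,\Gamma\Rightarrow\Delta$ / $\Gamma\Rightarrow\Delta,\neg\Box\alpha$; ($\neg\Diamond$left$^t$) $\Gamma\Rightarrow\Delta,\alpha$ / $\neg\Diamond\alpha,\Gamma\Rightarrow\Delta$. HTS5. A hypersequent is an expression $\Gamma_1\Rightarrow\Delta_1\mid\cdots\mid\Gamma_n\Rightarrow\Delta_n$, regarded as a finite multiset of sequents; $H,G$ range over hypersequents (possibly empty), and $S\mid H$ denotes adding the sequent $S$ to $H$. Initial hypersequents: for every propositional variable $p$: $p\Rightarrow p$, $\neg p\Rightarrow\neg p$, $p,\neg p\Rightarrow$, $\Rightarrow p,\neg p$. Structural rules: (cut) $\Gamma\Rightarrow\Delta,\alpha\mid H$; $\alpha,\Sigma\Rightarrow\Pi\mid G$ / $\Gamma,\Sigma\Rightarrow\Delta,\Pi\mid H\mid G$. (merge) $\Gamma\Rightarrow\Delta\mid\Sigma\Rightarrow\Pi\mid H$ / $\Gamma,\Sigma\Rightarrow\Delta,\Pi\mid H$. (in-we-left) $\Gamma\Rightarrow\Delta\mid H$ / $\alpha,\Gamma\Rightarrow\Delta\mid H$. (in-we-right) $\Gamma\Rightarrow\Delta\mid H$ / $\Gamma\Rightarrow\Delta,\alpha\mid H$. (ex-we-left) $H$ / $\alpha\Rightarrow\ \mid H$. (ex-we-right) $H$ / $\Rightarrow\alpha\mid H$. Non-twist logical rules: ($\wedge$left) $\alpha,\beta,\Gamma\Rightarrow\Delta\mid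 H$ / $\alpha\wedge\beta,\Gamma\Rightarrow\Delta\mid H$. ($\wedge$right) $\Gamma\Rightarrow\Delta,\alpha\mid H$; $\Gamma\Rightarrow\Delta,\beta\mid G$ / $\Gamma\Rightarrow\Delta,\alpha\wedge\beta\mid H\mid G$. ($\vee$left) $\alpha,\Gamma\Rightarrow\Delta\mid H$; $\beta,\Gamma\Rightarrow\Delta\mid G$ / $\alpha\vee\beta,\Gamma\Rightarrow\Delta\mid H\mid G$. ($\vee$right) $\Gamma\Rightarrow\Delta,\alpha,\beta\mid H$ / $\Gamma\Rightarrow\Delta,\alpha\vee\beta\mid H$. ($\to$left) $\Gamma\Rightarrow\Delta,\alpha\mid H$; $\beta,\Gamma\Rightarrow\Delta\mid G$ / $\alpha\to\beta,\Gamma\Rightarrow\Delta\mid H\mid G$. ($\to$right) $\alpha,\Gamma\Rightarrow\Delta,\beta\mid H$ / $\Gamma\Rightarrow\Delta,\alpha\to\beta\mid H$. ($\Box$left) $\alpha,\Gamma\Rightarrow\Delta\mid H$ / $\Box\alpha\Rightarrow\ \mid\Gamma\Rightarrow\Delta\mid H$. ($\Box$right) $\Rightarrow\alpha\mid H$ / $\Rightarrow\Box\alpha\mid H$. ($\Diamond$left) $\alpha\Rightarrow\ \mid H$ / $\Diamond\alpha\Rightarrow\ \mid H$. ($\Diamond$right) $\Gamma\Rightarrow\Delta,\alpha\mid H$ / $\Gamma\Rightarrow\Delta\mid\ \Rightarrow\Diamond\alpha\mid H$. Twist rules: ($\neg\neg$left) $\alpha,\Gamma\Rightarrow\Delta\mid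 H$ / $\neg\neg\alpha,\Gamma\Rightarrow\Delta\mid H$. ($\neg\neg$right) $\Gamma\Rightarrow\Delta,\alpha\mid H$ / $\Gamma\Rightarrow\Delta,\neg\neg\alpha\mid H$. ($\neg\wedge$left) $\Gamma\Rightarrow\Delta,\alpha\mid H$; $\Gamma\Rightarrow\Delta,\beta\mid G$ / $\neg(\alpha\wedge\beta),\Gamma\Rightarrow\Delta\mid H\mid G$. ($\neg\wedge$right) $\alpha,\beta,\Gamma\Rightarrow\Delta\mid H$ / $\Gamma\Rightarrow\Delta,\neg(\alpha\wedge\beta)\mid H$. ($\neg\vee$left) $\Gamma\Rightarrow\Delta,\alpha,\beta\mid H$ / $\neg(\alpha\vee\beta),\Gamma\Rightarrow\Delta\mid H$. ($\neg\vee$right) $\alpha,\Gamma\Rightarrow\Delta\mid H$; $\beta,\Gamma\Rightarrow\Delta\mid G$ / $\Gamma\Rightarrow\Delta,\neg(\alpha\vee\beta)\mid H\mid G$. ($\neg\to$left) $\alpha,\Gamma\Rightarrow\Delta,\beta\mid H$ / $\neg(\alpha\to\beta),\Gamma\Rightarrow\Delta\mid H$. ($\neg\to$right) $\Gamma\Rightarrow\Delta,\alpha\mid H$; $\beta,\Gamma\Rightarrow\Delta\mid G$ / $\Gamma\Rightarrow\Delta,\neg(\alpha\to\beta)\mid H\mid G$. ($\neg\Box$S5-left$^h$) $\Rightarrow\alpha\mid H$ / $\neg\Box\alpha\Rightarrow\ \mid H$. ($\neg\Box$S5-right$^h$) $\alpha,\Gamma\Rightarrow\Delta\mid H$ / $\Gamma\Rightarrow\Delta\mid\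 \Rightarrow\neg\Box\alpha\mid H$. ($\neg\Diamond$S5-left$^h$) $\Gamma\Rightarrow\Delta,\alpha\mid H$ / $\neg\Diamond\alpha\Rightarrow\ \mid\Gamma\Rightarrow\Delta\mid H$. ($\neg\Diamond$S5-right$^h$) $\alpha\Rightarrow\ \mid H$ / $\Rightarrow\neg\Diamond\alpha\mid H$. HTS5 has no other rules. *)

theory Defs
  imports "HOL-Library.FSet" "HOL-Library.Multiset"
begin

datatype form =
    Var nat
  | And form form (infixr "\<^bold>\<and>" 75)
  | Or form form (infixr "\<^bold>\<or>" 74)
  | Imp form form (infixr "\<^bold>\<rightarrow>" 73)
  | Neg form ("\<^bold>\<not> _" [80] 80)
  | Box form ("\<^bold>\<box> _" [80] 80)
  | Dia form ("\<^bold>\<diamond> _" [80] 80)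

primrec subformulas :: "form \<Rightarrow> form set" where
  "subformulas (Var p) = {Var p}"
| "subformulas (\<alpha> \<^bold>\<and> \<beta>) = {\<alpha> \<^bold>\<and> \<beta>} \<union> subformulas \<alpha> \<union> subformulas \<beta>"
| "subformulas (\<alpha> \<^bold>\<or> \<beta>) = {\<alpha> \<^bold>\<or> \<beta>} \<union> subformulas \<alpha> \<union> subformulas \<beta>"
| "subformulas (\<alpha> \<^bold>\<rightarrow> \<beta>) = {\<alpha> \<^bold>\<rightarrow> \<beta>} \<union> subformulas \<alpha> \<union> subformulas \<beta>"
| "subformulas (\<^bold>\<not> \<alpha>) = {\<^bold>\<not> \<alpha>} \<union> subformulas \<alpha>"
| "subformulas (\<^bold>\<box> \<alpha>) = {\<^bold>\<box> \<alpha>} \<union> subformulas \<alpha>"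
| "subformulas (\<^bold>\<diamond> \<alpha>) = {\<^bold>\<diamond> \<alpha>} \<union> subformulas \<alpha>"

datatype sequent = Sequent "form fset" "form fset" (infix "\<Rrightarrow>" 55)

type_synonym hypersequent = "sequent multiset"

primrec sequent_formulas :: "sequent \<Rightarrow> form set" where
  "sequent_formulas (\<Gamma> \<Rrightarrow> \<Delta>) = fset \<Gamma> \<union> fset \<Delta>"

definition hypersequent_formulas :: "hypersequent \<Rightarrow> form set" where
  "hypersequent_formulas H = (\<Union>S\<in>set_mset H. sequent_formulas S)"

text \<open>
  A calculus is a relation between the list of premises and the conclusion of its rule
  instances; initial (hyper)sequents are the instances without premises.
\<close>

type_synonym 's calculus = "'s list \<Rightarrow> 's \<Rightarrow> bool"

datatype 's ptree = Infer (root: 's) "'s ptree list"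

fun is_proof :: "'s calculus \<Rightarrow> 's ptree \<Rightarrow> bool" where
  "is_proof L (Infer S Ps) \<longleftrightarrow> L (map root Ps) S \<and> (\<forall>P\<in>set Ps. is_proof L P)"

definition proof_of :: "'s calculus \<Rightarrow> 's ptree \<Rightarrow> 's \<Rightarrow> bool" where
  "proof_of L P S \<longleftrightarrow> is_proof L P \<and> root P = S"

definition provable :: "'s calculus \<Rightarrow> 's \<Rightarrow> bool" where
  "provable L S \<longleftrightarrow> (\<exists>P. proof_of L P S)"

text \<open>
  The first parameter gives the formulas of a single (hyper)sequent; \<open>set_ptree P\<close>
  is the set of all (hyper)sequents labelling nodes of \<open>P\<close>.
\<close>

definition proof_formulas :: "('s \<Rightarrow> form set) \<Rightarrow> 's ptree \<Rightarrow> form set" where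
  "proof_formulas fms P = (\<Union>S\<in>set_ptree P. fms S)"

definition subformula_property :: "('s \<Rightarrow> form set) \<Rightarrow> 's calculus \<Rightarrow> bool" where
  "subformula_property fms L \<longleftrightarrow>
    (\<forall>S. provable L S \<longrightarrow>
      (\<exists>P. proof_of L P S \<and> (\<forall>\<phi>\<in>proof_formulas fms P. \<exists>\<psi>\<in>fms S. \<phi> \<in> subformulas \<psi>)))"

abbreviation Boxs :: "form fset \<Rightarrow> form fset" where
  "Boxs \<Gamma> \<equiv> (\<lambda>\<gamma>. \<^bold>\<box> \<gamma>) |`| \<Gamma>"
abbreviation Dias :: "form fset \<Rightarrow> form fset" where
  "Dias \<Gamma> \<equiv> (\<lambda>\<gamma>. \<^bold>\<diamond> \<gamma>) |`| \<Gamma>"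
abbreviation NegBoxs :: "form fset \<Rightarrow> form fset" where
  "NegBoxs \<Gamma> \<equiv> (\<lambda>\<gamma>. \<^bold>\<not> \<^bold>\<box> \<gamma>) |`| \<Gamma>"
abbreviation NegDias :: "form fset \<Rightarrow> form fset" where
  "NegDias \<Gamma> \<equiv> (\<lambda>\<gamma>. \<^bold>\<not> \<^bold>\<diamond> \<gamma>) |`| \<Gamma>"

inductive gTK :: "sequent calculus" where
  init_pos:
    "gTK []
      ({|Var p|} \<Rrightarrow> {|Var p|})"
| init_neg:
    "gTK []
      ({|\<^bold>\<not> Var p|} \<Rrightarrow> {|\<^bold>\<not> Var p|})"
| init_left:
    "gTK []
      ({|\<^bold>\<not> Var p, Var p|} \<Rrightarrow> {||})"
| init_right:
    "gTK []
      ({||} \<Rrightarrow> {|\<^bold>\<not> Var p, Var p|})"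
| cut:
    "gTK [\<Gamma> \<Rrightarrow> {|\<alpha>|}, finsert \<alpha> \<Gamma> \<Rrightarrow> \<Delta>]
      (\<Gamma> \<Rrightarrow> \<Delta>)"
| we_left:
    "gTK [\<Gamma> \<Rrightarrow> \<Delta>]
      (finsert \<alpha> \<Gamma> \<Rrightarrow> \<Delta>)"
| we_right:
    "gTK [\<Gamma> \<Rrightarrow> \<Delta>]
      (\<Gamma> \<Rrightarrow> finsert \<alpha> \<Delta>)"
| And_left:
    "gTK [finsert \<alpha> (finsert \<beta> \<Gamma>) \<Rrightarrow> \<Delta>]
      (finsert (\<alpha> \<^bold>\<and> \<beta>) \<Gamma> \<Rrightarrow> \<Delta>)"
| And_right:
    "gTK [\<Gamma> \<Rrightarrow> finsert \<alpha> \<Delta>, \<Gamma> \<Rrightarrow> finsert \<beta> \<Delta>]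
      (\<Gamma> \<Rrightarrow> finsert (\<alpha> \<^bold>\<and> \<beta>) \<Delta>)"
| Or_left:
    "gTK [finsert \<alpha> \<Gamma> \<Rrightarrow> \<Delta>, finsert \<beta> \<Gamma> \<Rrightarrow> \<Delta>]
      (finsert (\<alpha> \<^bold>\<or> \<beta>) \<Gamma> \<Rrightarrow> \<Delta>)"
| Or_right:
    "gTK [\<Gamma> \<Rrightarrow> finsert \<alpha> (finsert \<beta> \<Delta>)]
      (\<Gamma> \<Rrightarrow> finsert (\<alpha> \<^bold>\<or> \<beta>) \<Delta>)"
| Imp_left:
    "gTK [\<Gamma> \<Rrightarrow> finsert \<alpha> \<Delta>, finsert \<beta> \<Gamma> \<Rrightarrow> \<Delta>]
      (finsert (\<alpha> \<^bold>\<rightarrow> \<beta>) \<Gamma> \<Rrightarrow> \<Delta>)"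
| Imp_right:
    "gTK [finsert \<alpha> \<Gamma> \<Rrightarrow> finsert \<beta> \<Delta>]
      (\<Gamma> \<Rrightarrow> finsert (\<alpha> \<^bold>\<rightarrow> \<beta>) \<Delta>)"
| Neg_Neg_left:
    "gTK [finsert \<alpha> \<Gamma> \<Rrightarrow> \<Delta>]
      (finsert (\<^bold>\<not> \<^bold>\<not> \<alpha>) \<Gamma> \<Rrightarrow> \<Delta>)"
| Neg_Neg_right:
    "gTK [\<Gamma> \<Rrightarrow> finsert \<alpha> \<Delta>]
      (\<Gamma> \<Rrightarrow> finsert (\<^bold>\<not> \<^bold>\<not> \<alpha>) \<Delta>)"
| Neg_And_left:
    "gTK [\<Gamma> \<Rrightarrow> finsert \<alpha> \<Delta>, \<Gamma> \<Rrightarrow> finsert \<beta> \<Delta>]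
      (finsert (\<^bold>\<not> (\<alpha> \<^bold>\<and> \<beta>)) \<Gamma> \<Rrightarrow> \<Delta>)"
| Neg_And_right:
    "gTK [finsert \<alpha> (finsert \<beta> \<Gamma>) \<Rrightarrow> \<Delta>]
      (\<Gamma> \<Rrightarrow> finsert (\<^bold>\<not> (\<alpha> \<^bold>\<and> \<beta>)) \<Delta>)"
| Neg_Or_left:
    "gTK [\<Gamma> \<Rrightarrow> finsert \<alpha> (finsert \<beta> \<Delta>)]
      (finsert (\<^bold>\<not> (\<alpha> \<^bold>\<or> \<beta>)) \<Gamma> \<Rrightarrow> \<Delta>)"
| Neg_Or_right:
    "gTK [finsert \<alpha> \<Gamma> \<Rrightarrow> \<Delta>, finsert \<beta> \<Gamma> \<Rrightarrow> \<Delta>]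
      (\<Gamma> \<Rrightarrow> finsert (\<^bold>\<not> (\<alpha> \<^bold>\<or> \<beta>)) \<Delta>)"
| Neg_Imp_left:
    "gTK [finsert \<alpha> \<Gamma> \<Rrightarrow> finsert \<beta> \<Delta>]
      (finsert (\<^bold>\<not> (\<alpha> \<^bold>\<rightarrow> \<beta>)) \<Gamma> \<Rrightarrow> \<Delta>)"
| Neg_Imp_right:
    "gTK [\<Gamma> \<Rrightarrow> finsert \<alpha> \<Delta>, finsert \<beta> \<Gamma> \<Rrightarrow> \<Delta>]
      (\<Gamma> \<Rrightarrow> finsert (\<^bold>\<not> (\<alpha> \<^bold>\<rightarrow> \<beta>)) \<Delta>)"
| Box_K_right:
    "gTK [\<Gamma>\<^sub>1 |\<union>| \<Delta>\<^sub>2 \<Rrightarrow> finsert \<alpha> (\<Delta>\<^sub>1 |\<union>| \<Gamma>\<^sub>2)]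
      (Boxs \<Gamma>\<^sub>1 |\<union>| NegDias \<Gamma>\<^sub>2 \<Rrightarrow> finsert (\<^bold>\<box> \<alpha>) (Dias \<Delta>\<^sub>1 |\<union>| NegBoxs \<Delta>\<^sub>2))"
| Dia_K_left:
    "gTK [finsert \<alpha> (\<Gamma>\<^sub>1 |\<union>| \<Delta>\<^sub>2) \<Rrightarrow> \<Delta>\<^sub>1 |\<union>| \<Gamma>\<^sub>2]
      (finsert (\<^bold>\<diamond> \<alpha>) (Boxs \<Gamma>\<^sub>1 |\<union>| NegDias \<Gamma>\<^sub>2) \<Rrightarrow> Dias \<Delta>\<^sub>1 |\<union>| NegBoxs \<Delta>\<^sub>2)"
| Neg_Box_K_left:
    "gTK [\<Gamma>\<^sub>1 |\<union>| \<Delta>\<^sub>2 \<Rrightarrow> finsert \<alpha> (\<Delta>\<^sub>1 |\<union>| \<Gamma>\<^sub>2)]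
      (finsert (\<^bold>\<not> \<^bold>\<box> \<alpha>) (Boxs \<Gamma>\<^sub>1 |\<union>| NegDias \<Gamma>\<^sub>2) \<Rrightarrow> Dias \<Delta>\<^sub>1 |\<union>| NegBoxs \<Delta>\<^sub>2)"
| Neg_Dia_K_right:
    "gTK [finsert \<alpha> (\<Gamma>\<^sub>1 |\<union>| \<Delta>\<^sub>2) \<Rrightarrow> \<Delta>\<^sub>1 |\<union>| \<Gamma>\<^sub>2]
      (Boxs \<Gamma>\<^sub>1 |\<union>| NegDias \<Gamma>\<^sub>2 \<Rrightarrow> finsert (\<^bold>\<not> \<^bold>\<diamond> \<alpha>) (Dias \<Delta>\<^sub>1 |\<union>| NegBoxs \<Delta>\<^sub>2))"

inductive gTKT :: "sequent calculus" where
  gTK: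
    "gTK Ss S \<Longrightarrow> gTKT Ss S"
| Box_left:
    "gTKT [finsert \<alpha> \<Gamma> \<Rrightarrow> \<Delta>]
      (finsert (\<^bold>\<box> \<alpha>) \<Gamma> \<Rrightarrow> \<Delta>)"
| Dia_right:
    "gTKT [\<Gamma> \<Rrightarrow> finsert \<alpha> \<Delta>]
      (\<Gamma> \<Rrightarrow> finsert (\<^bold>\<diamond> \<alpha>) \<Delta>)"
| Neg_Box_right:
    "gTKT [finsert \<alpha> \<Gamma> \<Rrightarrow> \<Delta>]
      (\<Gamma> \<Rrightarrow> finsert (\<^bold>\<not> \<^bold>\<box> \<alpha>) \<Delta>)"
| Neg_Dia_left:
    "gTKT [\<Gamma> \<Rrightarrow> finsert \<alpha> \<Delta>]
      (finsert (\<^bold>\<not> \<^bold>\<diamond> \<alpha>) \<Gamma> \<Rrightarrow> \<Delta>)"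

inductive HTS5 :: "hypersequent calculus" where
  init_pos:
    "HTS5 []
      ({#{|Var p|} \<Rrightarrow> {|Var p|}#})"
| init_neg:
    "HTS5 []
      ({#{|\<^bold>\<not> Var p|} \<Rrightarrow> {|\<^bold>\<not> Var p|}#})"
| init_left:
    "HTS5 []
      ({#{|Var p, \<^bold>\<not> Var p|} \<Rrightarrow> {||}#})"
| init_right:
    "HTS5 []
      ({#{||} \<Rrightarrow> {|Var p, \<^bold>\<not> Var p|}#})"
| cut:
    "HTS5 [{#\<Gamma> \<Rrightarrow> finsert \<alpha> \<Delta>#} + H, {#finsert \<alpha> \<Sigma> \<Rrightarrow> \<Pi>#} + G]
      ({#\<Gamma> |\<union>| \<Sigma> \<Rrightarrow> \<Delta> |\<union>| \<Pi>#} + H + G)"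
| merge:
    "HTS5 [{#\<Gamma> \<Rrightarrow> \<Delta>, \<Sigma> \<Rrightarrow> \<Pi>#} + H]
      ({#\<Gamma> |\<union>| \<Sigma> \<Rrightarrow> \<Delta> |\<union>| \<Pi>#} + H)"
| in_we_left:
    "HTS5 [{#\<Gamma> \<Rrightarrow> \<Delta>#} + H]
      ({#finsert \<alpha> \<Gamma> \<Rrightarrow> \<Delta>#} + H)"
| in_we_right:
    "HTS5 [{#\<Gamma> \<Rrightarrow> \<Delta>#} + H]
      ({#\<Gamma> \<Rrightarrow> finsert \<alpha> \<Delta>#} + H)"
| ex_we_left:
    "HTS5 [H]
      ({#{|\<alpha>|} \<Rrightarrow> {||}#} + H)"
| ex_we_right:
    "HTS5 [H]
      ({#{||} \<Rrightarrow> {|\<alpha>|}#} + H)"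
| And_left:
    "HTS5 [{#finsert \<alpha> (finsert \<beta> \<Gamma>) \<Rrightarrow> \<Delta>#} + H]
      ({#finsert (\<alpha> \<^bold>\<and> \<beta>) \<Gamma> \<Rrightarrow> \<Delta>#} + H)"
| And_right:
    "HTS5 [{#\<Gamma> \<Rrightarrow> finsert \<alpha> \<Delta>#} + H, {#\<Gamma> \<Rrightarrow> finsert \<beta> \<Delta>#} + G]
      ({#\<Gamma> \<Rrightarrow> finsert (\<alpha> \<^bold>\<and> \<beta>) \<Delta>#} + H + G)"
| Or_left:
    "HTS5 [{#finsert \<alpha> \<Gamma> \<Rrightarrow> \<Delta>#} + H, {#finsert \<beta> \<Gamma> \<Rrightarrow> \<Delta>#} + G]
      ({#finsert (\<alpha> \<^bold>\<or> \<beta>) \<Gamma> \<Rrightarrow> \<Delta>#} + H + G)"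
| Or_right:
    "HTS5 [{#\<Gamma> \<Rrightarrow> finsert \<alpha> (finsert \<beta> \<Delta>)#} + H]
      ({#\<Gamma> \<Rrightarrow> finsert (\<alpha> \<^bold>\<or> \<beta>) \<Delta>#} + H)"
| Imp_left:
    "HTS5 [{#\<Gamma> \<Rrightarrow> finsert \<alpha> \<Delta>#} + H, {#finsert \<beta> \<Gamma> \<Rrightarrow> \<Delta>#} + G]
      ({#finsert (\<alpha> \<^bold>\<rightarrow> \<beta>) \<Gamma> \<Rrightarrow> \<Delta>#} + H + G)"
| Imp_right:
    "HTS5 [{#finsert \<alpha> \<Gamma> \<Rrightarrow> finsert \<beta> \<Delta>#} + H]
      ({#\<Gamma> \<Rrightarrow> finsert (\<alpha> \<^bold>\<rightarrow> \<beta>) \<Delta>#} + H)"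
| Box_left:
    "HTS5 [{#finsert \<alpha> \<Gamma> \<Rrightarrow> \<Delta>#} + H]
      ({#{|\<^bold>\<box> \<alpha>|} \<Rrightarrow> {||}, \<Gamma> \<Rrightarrow> \<Delta>#} + H)"
| Box_right:
    "HTS5 [{#{||} \<Rrightarrow> {|\<alpha>|}#} + H]
      ({#{||} \<Rrightarrow> {|\<^bold>\<box> \<alpha>|}#} + H)"
| Dia_left:
    "HTS5 [{#{|\<alpha>|} \<Rrightarrow> {||}#} + H]
      ({#{|\<^bold>\<diamond> \<alpha>|} \<Rrightarrow> {||}#} + H)"
| Dia_right:
    "HTS5 [{#\<Gamma> \<Rrightarrow> finsert \<alpha> \<Delta>#} + H]
      ({#\<Gamma> \<Rrightarrow> \<Delta>, {||} \<Rrightarrow> {|\<^bold>\<diamond> \<alpha>|}#} + H)"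
| Neg_Neg_left:
    "HTS5 [{#finsert \<alpha> \<Gamma> \<Rrightarrow> \<Delta>#} + H]
      ({#finsert (\<^bold>\<not> \<^bold>\<not> \<alpha>) \<Gamma> \<Rrightarrow> \<Delta>#} + H)"
| Neg_Neg_right:
    "HTS5 [{#\<Gamma> \<Rrightarrow> finsert \<alpha> \<Delta>#} + H]
      ({#\<Gamma> \<Rrightarrow> finsert (\<^bold>\<not> \<^bold>\<not> \<alpha>) \<Delta>#} + H)"
| Neg_And_left:
    "HTS5 [{#\<Gamma> \<Rrightarrow> finsert \<alpha> \<Delta>#} + H, {#\<Gamma> \<Rrightarrow> finsert \<beta> \<Delta>#} + G]
      ({#finsert (\<^bold>\<not> (\<alpha> \<^bold>\<and> \<beta>)) \<Gamma> \<Rrightarrow> \<Delta>#} + H + G)"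
| Neg_And_right:
    "HTS5 [{#finsert \<alpha> (finsert \<beta> \<Gamma>) \<Rrightarrow> \<Delta>#} + H]
      ({#\<Gamma> \<Rrightarrow> finsert (\<^bold>\<not> (\<alpha> \<^bold>\<and> \<beta>)) \<Delta>#} + H)"
| Neg_Or_left:
    "HTS5 [{#\<Gamma> \<Rrightarrow> finsert \<alpha> (finsert \<beta> \<Delta>)#} + H]
      ({#finsert (\<^bold>\<not> (\<alpha> \<^bold>\<or> \<beta>)) \<Gamma> \<Rrightarrow> \<Delta>#} + H)"
| Neg_Or_right:
    "HTS5 [{#finsert \<alpha> \<Gamma> \<Rrightarrow> \<Delta>#} + H, {#finsert \<beta> \<Gamma> \<Rrightarrow> \<Delta>#} + G]
      ({#\<Gamma> \<Rrightarrow> finsert (\<^bold>\<not> (\<alpha> \<^bold>\<or> \<beta>)) \<Delta>#} + H + G)"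
| Neg_Imp_left:
    "HTS5 [{#finsert \<alpha> \<Gamma> \<Rrightarrow> finsert \<beta> \<Delta>#} + H]
      ({#finsert (\<^bold>\<not> (\<alpha> \<^bold>\<rightarrow> \<beta>)) \<Gamma> \<Rrightarrow> \<Delta>#} + H)"
| Neg_Imp_right:
    "HTS5 [{#\<Gamma> \<Rrightarrow> finsert \<alpha> \<Delta>#} + H, {#finsert \<beta> \<Gamma> \<Rrightarrow> \<Delta>#} + G]
      ({#\<Gamma> \<Rrightarrow> finsert (\<^bold>\<not> (\<alpha> \<^bold>\<rightarrow> \<beta>)) \<Delta>#} + H + G)"
| Neg_Box_S5_left:
    "HTS5 [{#{||} \<Rrightarrow> {|\<alpha>|}#} + H]
      ({#{|\<^bold>\<not> \<^bold>\<box> \<alpha>|} \<Rrightarrow> {||}#} + H)"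
| Neg_Box_S5_right:
    "HTS5 [{#finsert \<alpha> \<Gamma> \<Rrightarrow> \<Delta>#} + H]
      ({#\<Gamma> \<Rrightarrow> \<Delta>, {||} \<Rrightarrow> {|\<^bold>\<not> \<^bold>\<box> \<alpha>|}#} + H)"
| Neg_Dia_S5_left:
    "HTS5 [{#\<Gamma> \<Rrightarrow> finsert \<alpha> \<Delta>#} + H]
      ({#{|\<^bold>\<not> \<^bold>\<diamond> \<alpha>|} \<Rrightarrow> {||}, \<Gamma> \<Rrightarrow> \<Delta>#} + H)"
| Neg_Dia_S5_right:
    "HTS5 [{#{|\<alpha>|} \<Rrightarrow> {||}#} + H]
      ({#{||} \<Rrightarrow> {|\<^bold>\<not> \<^bold>\<diamond> \<alpha>|}#} + H)"

end

theory Submission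
  imports Defs
begin

text \<open>
  All three calculi are complete for Kripke semantics with classical negation (over arbitrary,
  reflexive and universal frames, respectively) already when proofs may only use formulas from a
  finite set \<open>F\<close> closed under subformulas. For gTK and gTKT the worlds of the countermodel are the
  maximal sequents over \<open>F\<close> that have no proof inside \<open>F\<close>. For HTS5 one takes a maximal set \<open>X\<close> of
  sequents over \<open>F\<close> which, read as a hypersequent, has no proof inside \<open>F\<close>; the worlds are the
  inclusion-maximal elements of \<open>X\<close>. Since the full calculi are sound, every provable
  (hyper)sequent is valid and thus has a proof using its own subformulas only.
  Cut is needed only in HTS5, to weaken a hypersequent by the empty sequent.
\<close>

section \<open>Subformulas and restricted derivability\<close>

lemma subformulas_refl: "\<phi> \<in> subformulas \<phi>"
  by (cases \<phi>) auto

lemma subformulas_trans: "\<psi> \<in> subformulas \<phi> \<Longrightarrow> subformulas \<psi> \<subseteq> subformulas \<phi>"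
  by (induction \<phi>) auto

lemma finite_subformulas: "finite (subformulas \<phi>)"
  by (induction \<phi>) auto

lemma finite_sequent_formulas: "finite (sequent_formulas S)"
  by (cases S) simp

lemma finite_hypersequent_formulas: "finite (hypersequent_formulas H)"
  by (simp add: hypersequent_formulas_def finite_sequent_formulas)

text \<open>Existence of a proof whose nodes all stay inside \<open>F\<close>, phrased inductively
  so that rules can be applied without handling trees. With \<open>F\<close> the set of subformulas
  of the end sequent, this is what the subformula property asks for.\<close>

inductive deriv :: "('s \<Rightarrow> form set) \<Rightarrow> 's calculus \<Rightarrow> form set \<Rightarrow> 's \<Rightarrow> bool"
  for fms L F where
  deriv_infer: "L Ss S \<Longrightarrow> (\<And>T. T \<in> set Ss \<Longrightarrow> deriv fms L F T) \<Longrightarrow> fms S \<subseteq> F \<Longrightarrow> deriv fms L F S"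

lemma deriv_infer0: "L [] S \<Longrightarrow> fms S \<subseteq> F \<Longrightarrow> deriv fms L F S"
  by (rule deriv_infer) auto

lemma deriv_infer1: "L [T] S \<Longrightarrow> deriv fms L F T \<Longrightarrow> fms S \<subseteq> F \<Longrightarrow> deriv fms L F S"
  by (rule deriv_infer) auto

lemma deriv_infer2:
  "L [T, U] S \<Longrightarrow> deriv fms L F T \<Longrightarrow> deriv fms L F U \<Longrightarrow> fms S \<subseteq> F \<Longrightarrow> deriv fms L F S"
  by (rule deriv_infer) auto

lemma deriv_formulas: "deriv fms L F S \<Longrightarrow> fms S \<subseteq> F"
  by (auto elim: deriv.cases)

text \<open>Trees chosen for the premises are grafted under a new root. The choice is a function of
  the premise, so a repeated premise receives the same tree each time.\<close>

lemma deriv_proof: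
  "deriv fms L F S \<Longrightarrow> \<exists>P. proof_of L P S \<and> proof_formulas fms P \<subseteq> F"
proof (induction rule: deriv.induct)
  case (deriv_infer Ss S)
  then have "\<forall>T\<in>set Ss. \<exists>P. proof_of L P T \<and> proof_formulas fms P \<subseteq> F" by blast
  then obtain f where f: "\<forall>T\<in>set Ss. proof_of L (f T) T \<and> proof_formulas fms (f T) \<subseteq> F"
    by metis
  have roots: "map (root \<circ> f) Ss = Ss"
    by (rule map_idI) (use f in \<open>auto simp: proof_of_def\<close>)
  have "proof_of L (Infer S (map f Ss)) S"
    using f roots deriv_infer.hyps by (auto simp: proof_of_def)
  moreover have "proof_formulas fms (Infer S (map f Ss)) \<subseteq> F"
    using f deriv_infer.hyps by (auto simp: proof_formulas_def)
  ultimately show ?case by blast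
qed

text \<open>Here \<open>Q\<close> will be truth in one fixed model, or truth on a universal frame
  for hypersequents.\<close>

lemma provable_sound:
  assumes "provable L S" and sound: "\<And>Ss S. L Ss S \<Longrightarrow> (\<And>T. T \<in> set Ss \<Longrightarrow> Q T) \<Longrightarrow> Q S"
  shows "Q S"
proof -
  have "is_proof L P \<Longrightarrow> Q (root P)" for P
  proof (induction P)
    case (Infer S Ps)
    show ?case unfolding ptree.sel by (rule sound[of "map root Ps"]) (use Infer in auto)
  qed
  with assms(1) show ?thesis by (auto simp: provable_def proof_of_def)
qed

text \<open>Reduces the theorem to analytic completeness: the subformulas of the end sequent form a
  finite set closed under subformulas, so \<open>compl\<close> applies to it.\<close>

lemma subformula_propertyI:
  assumes fin: "\<And>S. finite (fms S)"
    and compl: "\<And>F S. finite F \<Longrightarrow> (\<And>\<phi>. \<phi> \<in> F \<Longrightarrow> subformulas \<phi> \<subseteq> F) \<Longrightarrow>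
      fms S \<subseteq> F \<Longrightarrow> provable L S \<Longrightarrow> deriv fms L F S"
  shows "subformula_property fms L"
  unfolding subformula_property_def
proof (intro allI impI)
  fix S assume S: "provable L S"
  define F where "F = (\<Union>\<psi>\<in>fms S. subformulas \<psi>)"
  have "deriv fms L F S"
  proof (rule compl)
    show "finite F" by (simp add: F_def fin finite_subformulas)
    show "subformulas \<phi> \<subseteq> F" if "\<phi> \<in> F" for \<phi>
      using that subformulas_trans by (fastforce simp: F_def)
    show "fms S \<subseteq> F" using subformulas_refl by (auto simp: F_def)
  qed (rule S)
  then obtain P where "proof_of L P S" "proof_formulas fms P \<subseteq> F"
    using deriv_proof by metis
  then show "\<exists>P. proof_of L P S \<and> (\<forall>\<phi>\<in>proof_formulas fms P. \<exists>\<psi>\<in>fms S. \<phi> \<in> subformulas \<psi>)"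
    unfolding F_def by blast
qed

section \<open>Kripke semantics and soundness\<close>

primrec holds :: "('w \<Rightarrow> 'w \<Rightarrow> bool) \<Rightarrow> ('w \<Rightarrow> nat \<Rightarrow> bool) \<Rightarrow> 'w \<Rightarrow> form \<Rightarrow> bool" where
  "holds R V w (Var p) \<longleftrightarrow> V w p"
| "holds R V w (\<alpha> \<^bold>\<and> \<beta>) \<longleftrightarrow> holds R V w \<alpha> \<and> holds R V w \<beta>"
| "holds R V w (\<alpha> \<^bold>\<or> \<beta>) \<longleftrightarrow> holds R V w \<alpha> \<or> holds R V w \<beta>"
| "holds R V w (\<alpha> \<^bold>\<rightarrow> \<beta>) \<longleftrightarrow> (holds R V w \<alpha> \<longrightarrow> holds R V w \<beta>)"
| "holds R V w (\<^bold>\<not> \<alpha>) \<longleftrightarrow> \<not> holds R V w \<alpha>"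
| "holds R V w (\<^bold>\<box> \<alpha>) \<longleftrightarrow> (\<forall>v. R w v \<longrightarrow> holds R V v \<alpha>)"
| "holds R V w (\<^bold>\<diamond> \<alpha>) \<longleftrightarrow> (\<exists>v. R w v \<and> holds R V v \<alpha>)"

definition refuted :: "('w \<Rightarrow> 'w \<Rightarrow> bool) \<Rightarrow> ('w \<Rightarrow> nat \<Rightarrow> bool) \<Rightarrow> 'w \<Rightarrow> form fset \<Rightarrow> form fset \<Rightarrow> bool" where
  "refuted R V w \<Gamma> \<Delta> \<longleftrightarrow> (\<forall>\<gamma>\<in>fset \<Gamma>. holds R V w \<gamma>) \<and> (\<forall>\<delta>\<in>fset \<Delta>. \<not> holds R V w \<delta>)"

primrec holds_seq :: "('w \<Rightarrow> 'w \<Rightarrow> bool) \<Rightarrow> ('w \<Rightarrow> nat \<Rightarrow> bool) \<Rightarrow> 'w \<Rightarrow> sequent \<Rightarrow> bool" where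
  "holds_seq R V w (\<Gamma> \<Rrightarrow> \<Delta>) \<longleftrightarrow> \<not> refuted R V w \<Gamma> \<Delta>"

lemma refuted_empty [simp]: "refuted R V w {||} {||}"
  by (simp add: refuted_def)

lemma refuted_finsert_left [simp]:
  "refuted R V w (finsert \<alpha> \<Gamma>) \<Delta> \<longleftrightarrow> holds R V w \<alpha> \<and> refuted R V w \<Gamma> \<Delta>"
  by (auto simp: refuted_def)

lemma refuted_finsert_right [simp]:
  "refuted R V w \<Gamma> (finsert \<alpha> \<Delta>) \<longleftrightarrow> \<not> holds R V w \<alpha> \<and> refuted R V w \<Gamma> \<Delta>"
  by (auto simp: refuted_def)

lemma refuted_union:
  "refuted R V w (\<Gamma> |\<union>| \<Sigma>) (\<Delta> |\<union>| \<Pi>) \<longleftrightarrow> refuted R V w \<Gamma> \<Delta> \<and> refuted R V w \<Sigma> \<Pi>"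
  by (auto simp: refuted_def)

text \<open>All four K rules share this context. Negated formulas change sides when the prefix is
  stripped, which is the twist in the rules. At a world without successors both sides hold
  trivially.\<close>

lemma refuted_modal:
  "refuted R V w (Boxs \<Gamma>\<^sub>1 |\<union>| NegDias \<Gamma>\<^sub>2) (Dias \<Delta>\<^sub>1 |\<union>| NegBoxs \<Delta>\<^sub>2) \<longleftrightarrow>
   (\<forall>v. R w v \<longrightarrow> refuted R V v (\<Gamma>\<^sub>1 |\<union>| \<Delta>\<^sub>2) (\<Delta>\<^sub>1 |\<union>| \<Gamma>\<^sub>2))"
  by (auto simp: refuted_def ball_Un)

text \<open>Meant for cut in gTK, whose left premise
  \<open>\<Gamma> \<Rrightarrow> {|\<alpha>|}\<close> lacks the succedent of the conclusion.\<close>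

lemma refuted_drop_right: "refuted R V w \<Gamma> \<Delta> \<Longrightarrow> refuted R V w \<Gamma> {||}"
  by (simp add: refuted_def)

text \<open>Truth is demanded at all worlds of \<open>W\<close> simultaneously because the K rules
  evaluate their premise at successors. The set \<open>W\<close> allows a model whose worlds are
  only some elements of the type.\<close>

lemma gTK_sound:
  assumes "gTK Ss S" and prems: "\<forall>T\<in>set Ss. \<forall>w\<in>W. holds_seq R V w T"
    and R: "\<And>w v. R w v \<Longrightarrow> v \<in> W"
  shows "\<forall>w\<in>W. holds_seq R V w S"
  using assms(1,2)
  by (cases rule: gTK.cases) (auto simp: refuted_modal dest: R refuted_drop_right)

text \<open>The four additional rules keep the premise at the same world, so each reduces to
  reflexivity there.\<close>

lemma gTKT_sound:
  assumes "gTKT Ss S" and prems: "\<forall>T\<in>set Ss. \<forall>w\<in>W. holds_seq R V w T"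
    and R: "\<And>w v. R w v \<Longrightarrow> v \<in> W" and refl: "\<And>w. w \<in> W \<Longrightarrow> R w w"
  shows "\<forall>w\<in>W. holds_seq R V w S"
  using assms(1,2)
proof (cases rule: gTKT.cases)
  case gTK
  then show ?thesis using prems R by (rule gTK_sound)
qed (simp_all, (use refl in blast)+)

text \<open>
  On a universal frame the components may be evaluated at independent worlds, so a hypersequent
  is true if and only if one of its components is true everywhere.
\<close>

lemma HTS5_sound:
  assumes "HTS5 Hs H"
    and prems: "\<forall>G\<in>set Hs. \<exists>S\<in>#G. \<forall>w\<in>W. holds_seq (\<lambda>_ v. v \<in> W) V w S"
  shows "\<exists>S\<in>#H. \<forall>w\<in>W. holds_seq (\<lambda>_ v. v \<in> W) V w S"
  using assms
  by (cases rule: HTS5.cases) (auto simp: refuted_union)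

section \<open>Saturated sequents and the truth lemma\<close>

primrec antecedent :: "sequent \<Rightarrow> form fset" where
  "antecedent (\<Gamma> \<Rrightarrow> \<Delta>) = \<Gamma>"

primrec succedent :: "sequent \<Rightarrow> form fset" where
  "succedent (\<Gamma> \<Rrightarrow> \<Delta>) = \<Delta>"

text \<open>A Hintikka condition: no initial sequent is contained, and whenever the principal
  formula of a propositional rule is present, so are the active formulas of one of its
  premises.\<close>

definition saturated :: "form fset \<Rightarrow> form fset \<Rightarrow> bool" where
  "saturated \<Gamma> \<Delta> \<longleftrightarrow>
    (\<forall>p. \<not> (Var p |\<in>| \<Gamma> \<and> Var p |\<in>| \<Delta>)) \<and>
    (\<forall>p. \<not> (\<^bold>\<not> Var p |\<in>| \<Gamma> \<and> \<^bold>\<not> Var p |\<in>| \<Delta>)) \<and>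
    (\<forall>p. \<not> (\<^bold>\<not> Var p |\<in>| \<Gamma> \<and> Var p |\<in>| \<Gamma>)) \<and>
    (\<forall>p. \<not> (\<^bold>\<not> Var p |\<in>| \<Delta> \<and> Var p |\<in>| \<Delta>)) \<and>
    (\<forall>\<alpha> \<beta>. (\<alpha> \<^bold>\<and> \<beta>) |\<in>| \<Gamma> \<longrightarrow> \<alpha> |\<in>| \<Gamma> \<and> \<beta> |\<in>| \<Gamma>) \<and>
    (\<forall>\<alpha> \<beta>. (\<alpha> \<^bold>\<and> \<beta>) |\<in>| \<Delta> \<longrightarrow> \<alpha> |\<in>| \<Delta> \<or> \<beta> |\<in>| \<Delta>) \<and>
    (\<forall>\<alpha> \<beta>. (\<alpha> \<^bold>\<or> \<beta>) |\<in>| \<Gamma> \<longrightarrow> \<alpha> |\<in>| \<Gamma> \<or> \<beta> |\<in>| \<Gamma>) \<and>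
    (\<forall>\<alpha> \<beta>. (\<alpha> \<^bold>\<or> \<beta>) |\<in>| \<Delta> \<longrightarrow> \<alpha> |\<in>| \<Delta> \<and> \<beta> |\<in>| \<Delta>) \<and>
    (\<forall>\<alpha> \<beta>. (\<alpha> \<^bold>\<rightarrow> \<beta>) |\<in>| \<Gamma> \<longrightarrow> \<alpha> |\<in>| \<Delta> \<or> \<beta> |\<in>| \<Gamma>) \<and>
    (\<forall>\<alpha> \<beta>. (\<alpha> \<^bold>\<rightarrow> \<beta>) |\<in>| \<Delta> \<longrightarrow> \<alpha> |\<in>| \<Gamma> \<and> \<beta> |\<in>| \<Delta>) \<and>
    (\<forall>\<alpha>. \<^bold>\<not> \<^bold>\<not> \<alpha> |\<in>| \<Gamma> \<longrightarrow> \<alpha> |\<in>| \<Gamma>) \<and>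
    (\<forall>\<alpha>. \<^bold>\<not> \<^bold>\<not> \<alpha> |\<in>| \<Delta> \<longrightarrow> \<alpha> |\<in>| \<Delta>) \<and>
    (\<forall>\<alpha> \<beta>. \<^bold>\<not> (\<alpha> \<^bold>\<and> \<beta>) |\<in>| \<Gamma> \<longrightarrow> \<alpha> |\<in>| \<Delta> \<or> \<beta> |\<in>| \<Delta>) \<and>
    (\<forall>\<alpha> \<beta>. \<^bold>\<not> (\<alpha> \<^bold>\<and> \<beta>) |\<in>| \<Delta> \<longrightarrow> \<alpha> |\<in>| \<Gamma> \<and> \<beta> |\<in>| \<Gamma>) \<and>
    (\<forall>\<alpha> \<beta>. \<^bold>\<not> (\<alpha> \<^bold>\<or> \<beta>) |\<in>| \<Gamma> \<longrightarrow> \<alpha> |\<in>| \<Delta> \<and> \<beta> |\<in>| \<Delta>) \<and>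
    (\<forall>\<alpha> \<beta>. \<^bold>\<not> (\<alpha> \<^bold>\<or> \<beta>) |\<in>| \<Delta> \<longrightarrow> \<alpha> |\<in>| \<Gamma> \<or> \<beta> |\<in>| \<Gamma>) \<and>
    (\<forall>\<alpha> \<beta>. \<^bold>\<not> (\<alpha> \<^bold>\<rightarrow> \<beta>) |\<in>| \<Gamma> \<longrightarrow> \<alpha> |\<in>| \<Gamma> \<and> \<beta> |\<in>| \<Delta>) \<and>
    (\<forall>\<alpha> \<beta>. \<^bold>\<not> (\<alpha> \<^bold>\<rightarrow> \<beta>) |\<in>| \<Delta> \<longrightarrow> \<alpha> |\<in>| \<Delta> \<or> \<beta> |\<in>| \<Gamma>)"

text \<open>The relation is a parameter so that one truth lemma serves both the canonical relation
  of gTK and gTKT and the universal relation of HTS5.\<close>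

definition modal_saturated :: "(sequent \<Rightarrow> sequent \<Rightarrow> bool) \<Rightarrow> sequent \<Rightarrow> bool" where
  "modal_saturated R w \<longleftrightarrow>
    (\<forall>\<alpha>. \<^bold>\<box> \<alpha> |\<in>| antecedent w \<longrightarrow> (\<forall>v. R w v \<longrightarrow> \<alpha> |\<in>| antecedent v)) \<and>
    (\<forall>\<alpha>. \<^bold>\<box> \<alpha> |\<in>| succedent w \<longrightarrow> (\<exists>v. R w v \<and> \<alpha> |\<in>| succedent v)) \<and>
    (\<forall>\<alpha>. \<^bold>\<diamond> \<alpha> |\<in>| antecedent w \<longrightarrow> (\<exists>v. R w v \<and> \<alpha> |\<in>| antecedent v)) \<and>
    (\<forall>\<alpha>. \<^bold>\<diamond> \<alpha> |\<in>| succedent w \<longrightarrow> (\<forall>v. R w v \<longrightarrow> \<alpha> |\<in>| succedent v)) \<and>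
    (\<forall>\<alpha>. \<^bold>\<not> \<^bold>\<box> \<alpha> |\<in>| antecedent w \<longrightarrow> (\<exists>v. R w v \<and> \<alpha> |\<in>| succedent v)) \<and>
    (\<forall>\<alpha>. \<^bold>\<not> \<^bold>\<box> \<alpha> |\<in>| succedent w \<longrightarrow> (\<forall>v. R w v \<longrightarrow> \<alpha> |\<in>| antecedent v)) \<and>
    (\<forall>\<alpha>. \<^bold>\<not> \<^bold>\<diamond> \<alpha> |\<in>| antecedent w \<longrightarrow> (\<forall>v. R w v \<longrightarrow> \<alpha> |\<in>| succedent v)) \<and>
    (\<forall>\<alpha>. \<^bold>\<not> \<^bold>\<diamond> \<alpha> |\<in>| succedent w \<longrightarrow> (\<exists>v. R w v \<and> \<alpha> |\<in>| antecedent v))"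

text \<open>Saturation does not move a negated variable across the arrow, so such a formula in the
  succedent must make the variable true by itself. The four initial-sequent clauses of
  \<open>saturated\<close> rule out conflicts.\<close>

definition canonical_val :: "sequent \<Rightarrow> nat \<Rightarrow> bool" where
  "canonical_val w p \<longleftrightarrow> Var p |\<in>| antecedent w \<or> \<^bold>\<not> Var p |\<in>| succedent w"

text \<open>
  The rules for \<open>\<^bold>\<not>\<close> look at the connective below the negation, so membership of a formula and of
  its negation have to be treated in one induction.
\<close>

lemma truth_lemma:
  assumes sat: "\<And>w. w \<in> W \<Longrightarrow> saturated (antecedent w) (succedent w)"
    and modal: "\<And>w. w \<in> W \<Longrightarrow> modal_saturated R w"
    and R: "\<And>w v. R w v \<Longrightarrow> v \<in> W"
    and "w \<in> W"
  shows "(\<phi> |\<in>| antecedent w \<longrightarrow> holds R canonical_val w \<phi>) \<and>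
    (\<phi> |\<in>| succedent w \<longrightarrow> \<not> holds R canonical_val w \<phi>) \<and>
    (\<^bold>\<not> \<phi> |\<in>| antecedent w \<longrightarrow> \<not> holds R canonical_val w \<phi>) \<and>
    (\<^bold>\<not> \<phi> |\<in>| succedent w \<longrightarrow> holds R canonical_val w \<phi>)"
  using \<open>w \<in> W\<close>
proof (induction \<phi> arbitrary: w)
  case (Var p)
  show ?case using sat[OF Var] unfolding saturated_def canonical_val_def holds.simps by metis
next
  case (And \<alpha> \<beta>)
  show ?case using sat[OF And.prems] And.IH[OF And.prems] unfolding saturated_def holds.simps by metis
next
  case (Or \<alpha> \<beta>)
  show ?case using sat[OF Or.prems] Or.IH[OF Or.prems] unfolding saturated_def holds.simps by metis
next
  case (Imp \<alpha> \<beta>)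
  show ?case using sat[OF Imp.prems] Imp.IH[OF Imp.prems] unfolding saturated_def holds.simps by metis
next
  case (Neg \<alpha>)
  show ?case using sat[OF Neg.prems] Neg.IH[OF Neg.prems] unfolding saturated_def holds.simps by metis
next
  case (Box \<alpha>)
  show ?case using modal[OF Box.prems] Box.IH R unfolding modal_saturated_def holds.simps by (metis (full_types))
next
  case (Dia \<alpha>)
  show ?case using modal[OF Dia.prems] Dia.IH R unfolding modal_saturated_def holds.simps by (metis (full_types))
qed

section \<open>Maximal extensions of sequents\<close>

definition extends :: "sequent \<Rightarrow> sequent \<Rightarrow> bool" where
  "extends S T \<longleftrightarrow> antecedent S |\<subseteq>| antecedent T \<and> succedent S |\<subseteq>| succedent T"

lemma extends_simps [simp]: "extends (\<Gamma> \<Rrightarrow> \<Delta>) T \<longleftrightarrow> \<Gamma> |\<subseteq>| antecedent T \<and> \<Delta> |\<subseteq>| succedent T"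
  by (simp add: extends_def)

lemma sequent_formulas_eq: "sequent_formulas S = fset (antecedent S) \<union> fset (succedent S)"
  by (cases S) simp

text \<open>By the truth lemma a world makes its own antecedent true and its own succedent false;
  this passes to every sequent contained in it.\<close>

lemma canonical_refutes:
  assumes sat: "\<And>w. w \<in> W \<Longrightarrow> saturated (antecedent w) (succedent w)"
    and modal: "\<And>w. w \<in> W \<Longrightarrow> modal_saturated R w"
    and R: "\<And>w v. R w v \<Longrightarrow> v \<in> W"
    and w: "w \<in> W" "extends S w"
  shows "\<not> holds_seq R canonical_val w S"
proof (cases S)
  case (Sequent \<Gamma> \<Delta>)
  then show ?thesis
    using w(2) truth_lemma[OF sat modal R w(1)] by (auto simp: refuted_def)
qed

definition maximal :: "(sequent \<Rightarrow> bool) \<Rightarrow> sequent \<Rightarrow> bool" where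
  "maximal Q S \<longleftrightarrow> Q S \<and> (\<forall>T. Q T \<longrightarrow> extends S T \<longrightarrow> T = S)"

text \<open>Both sides are subsets of \<open>F\<close>, so sizes are bounded and an extension of
  greatest total size exists.\<close>

lemma maximal_extension:
  assumes "finite F" and Q: "\<And>T. Q T \<Longrightarrow> sequent_formulas T \<subseteq> F" and "Q S"
  obtains T where "extends S T" "maximal Q T"
proof -
  let ?Q = "\<lambda>T. extends S T \<and> Q T"
  let ?size = "\<lambda>T. fcard (antecedent T) + fcard (succedent T)"
  have "?size T < 2 * card F + 1" if "?Q T" for T
  proof -
    have "fset (antecedent T) \<subseteq> F" "fset (succedent T) \<subseteq> F"
      using Q that by (auto simp: sequent_formulas_eq)
    then have "fcard (antecedent T) \<le> card F" "fcard (succedent T) \<le> card F"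
      using card_mono[OF \<open>finite F\<close>] by (auto simp: fcard.rep_eq)
    then show ?thesis by simp
  qed
  moreover have "?Q S" using \<open>Q S\<close> by (simp add: extends_def)
  ultimately obtain T where T: "?Q T" and max: "\<And>U. ?Q U \<Longrightarrow> ?size U \<le> ?size T"
    using ex_has_greatest_nat[of ?Q S ?size "2 * card F + 1"] by blast
  have "U = T" if "Q U" "extends T U" for U
  proof -
    have "?Q U" using that T by (auto simp: extends_def)
    then have le: "?size U \<le> ?size T" by (rule max)
    have sub: "antecedent T |\<subseteq>| antecedent U" "succedent T |\<subseteq>| succedent U"
      using that(2) by (auto simp: extends_def)
    \<comment> \<open>Each side can only grow while the total does not, so both cardinalities agree
      and the inclusions become equalities.\<close>
    then have "fcard (antecedent T) \<le> fcard (antecedent U)" "fcard (succedent T) \<le> fcard (succedent U)"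
      by (simp_all add: fcard_mono)
    then have "antecedent T = antecedent U" "succedent T = succedent U"
      using le fcard_seteq[OF sub(1)] fcard_seteq[OF sub(2)] by simp_all
    then show "U = T" by (cases T, cases U) simp
  qed
  then show ?thesis using that T by (auto simp: maximal_def)
qed

text \<open>
  The logical rules are stated with the principal formula kept in the premises; for HTS5 the
  predicate \<open>P\<close> is derivability together with a fixed side hypersequent.
\<close>

locale propositional_closure =
  fixes F :: "form set" and P :: "sequent \<Rightarrow> bool"
  assumes fin: "finite F"
    and closed: "\<And>\<phi>. \<phi> \<in> F \<Longrightarrow> subformulas \<phi> \<subseteq> F"
    and init_pos: "sequent_formulas (\<Gamma> \<Rrightarrow> \<Delta>) \<subseteq> F \<Longrightarrow> Var p |\<in>| \<Gamma> \<Longrightarrow> Var p |\<in>| \<Delta> \<Longrightarrow> P (\<Gamma> \<Rrightarrow> \<Delta>)"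
    and init_neg: "sequent_formulas (\<Gamma> \<Rrightarrow> \<Delta>) \<subseteq> F \<Longrightarrow> \<^bold>\<not> Var p |\<in>| \<Gamma> \<Longrightarrow> \<^bold>\<not> Var p |\<in>| \<Delta> \<Longrightarrow> P (\<Gamma> \<Rrightarrow> \<Delta>)"
    and init_left: "sequent_formulas (\<Gamma> \<Rrightarrow> \<Delta>) \<subseteq> F \<Longrightarrow> \<^bold>\<not> Var p |\<in>| \<Gamma> \<Longrightarrow> Var p |\<in>| \<Gamma> \<Longrightarrow> P (\<Gamma> \<Rrightarrow> \<Delta>)"
    and init_right: "sequent_formulas (\<Gamma> \<Rrightarrow> \<Delta>) \<subseteq> F \<Longrightarrow> \<^bold>\<not> Var p |\<in>| \<Delta> \<Longrightarrow> Var p |\<in>| \<Delta> \<Longrightarrow> P (\<Gamma> \<Rrightarrow> \<Delta>)"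
    and And_left: "sequent_formulas (\<Gamma> \<Rrightarrow> \<Delta>) \<subseteq> F \<Longrightarrow> (\<alpha> \<^bold>\<and> \<beta>) |\<in>| \<Gamma> \<Longrightarrow>
      P (finsert \<alpha> (finsert \<beta> \<Gamma>) \<Rrightarrow> \<Delta>) \<Longrightarrow> P (\<Gamma> \<Rrightarrow> \<Delta>)"
    and And_right: "sequent_formulas (\<Gamma> \<Rrightarrow> \<Delta>) \<subseteq> F \<Longrightarrow> (\<alpha> \<^bold>\<and> \<beta>) |\<in>| \<Delta> \<Longrightarrow>
      P (\<Gamma> \<Rrightarrow> finsert \<alpha> \<Delta>) \<Longrightarrow> P (\<Gamma> \<Rrightarrow> finsert \<beta> \<Delta>) \<Longrightarrow> P (\<Gamma> \<Rrightarrow> \<Delta>)"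
    and Or_left: "sequent_formulas (\<Gamma> \<Rrightarrow> \<Delta>) \<subseteq> F \<Longrightarrow> (\<alpha> \<^bold>\<or> \<beta>) |\<in>| \<Gamma> \<Longrightarrow>
      P (finsert \<alpha> \<Gamma> \<Rrightarrow> \<Delta>) \<Longrightarrow> P (finsert \<beta> \<Gamma> \<Rrightarrow> \<Delta>) \<Longrightarrow> P (\<Gamma> \<Rrightarrow> \<Delta>)"
    and Or_right: "sequent_formulas (\<Gamma> \<Rrightarrow> \<Delta>) \<subseteq> F \<Longrightarrow> (\<alpha> \<^bold>\<or> \<beta>) |\<in>| \<Delta> \<Longrightarrow>
      P (\<Gamma> \<Rrightarrow> finsert \<alpha> (finsert \<beta> \<Delta>)) \<Longrightarrow> P (\<Gamma> \<Rrightarrow> \<Delta>)"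
    and Imp_left: "sequent_formulas (\<Gamma> \<Rrightarrow> \<Delta>) \<subseteq> F \<Longrightarrow> (\<alpha> \<^bold>\<rightarrow> \<beta>) |\<in>| \<Gamma> \<Longrightarrow>
      P (\<Gamma> \<Rrightarrow> finsert \<alpha> \<Delta>) \<Longrightarrow> P (finsert \<beta> \<Gamma> \<Rrightarrow> \<Delta>) \<Longrightarrow> P (\<Gamma> \<Rrightarrow> \<Delta>)"
    and Imp_right: "sequent_formulas (\<Gamma> \<Rrightarrow> \<Delta>) \<subseteq> F \<Longrightarrow> (\<alpha> \<^bold>\<rightarrow> \<beta>) |\<in>| \<Delta> \<Longrightarrow>
      P (finsert \<alpha> \<Gamma> \<Rrightarrow> finsert \<beta> \<Delta>) \<Longrightarrow> P (\<Gamma> \<Rrightarrow> \<Delta>)"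
    and Neg_Neg_left: "sequent_formulas (\<Gamma> \<Rrightarrow> \<Delta>) \<subseteq> F \<Longrightarrow> \<^bold>\<not> \<^bold>\<not> \<alpha> |\<in>| \<Gamma> \<Longrightarrow>
      P (finsert \<alpha> \<Gamma> \<Rrightarrow> \<Delta>) \<Longrightarrow> P (\<Gamma> \<Rrightarrow> \<Delta>)"
    and Neg_Neg_right: "sequent_formulas (\<Gamma> \<Rrightarrow> \<Delta>) \<subseteq> F \<Longrightarrow> \<^bold>\<not> \<^bold>\<not> \<alpha> |\<in>| \<Delta> \<Longrightarrow>
      P (\<Gamma> \<Rrightarrow> finsert \<alpha> \<Delta>) \<Longrightarrow> P (\<Gamma> \<Rrightarrow> \<Delta>)"
    and Neg_And_left: "sequent_formulas (\<Gamma> \<Rrightarrow> \<Delta>) \<subseteq> F \<Longrightarrow> \<^bold>\<not> (\<alpha> \<^bold>\<and> \<beta>) |\<in>| \<Gamma> \<Longrightarrow>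
      P (\<Gamma> \<Rrightarrow> finsert \<alpha> \<Delta>) \<Longrightarrow> P (\<Gamma> \<Rrightarrow> finsert \<beta> \<Delta>) \<Longrightarrow> P (\<Gamma> \<Rrightarrow> \<Delta>)"
    and Neg_And_right: "sequent_formulas (\<Gamma> \<Rrightarrow> \<Delta>) \<subseteq> F \<Longrightarrow> \<^bold>\<not> (\<alpha> \<^bold>\<and> \<beta>) |\<in>| \<Delta> \<Longrightarrow>
      P (finsert \<alpha> (finsert \<beta> \<Gamma>) \<Rrightarrow> \<Delta>) \<Longrightarrow> P (\<Gamma> \<Rrightarrow> \<Delta>)"
    and Neg_Or_left: "sequent_formulas (\<Gamma> \<Rrightarrow> \<Delta>) \<subseteq> F \<Longrightarrow> \<^bold>\<not> (\<alpha> \<^bold>\<or> \<beta>) |\<in>| \<Gamma> \<Longrightarrow>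
      P (\<Gamma> \<Rrightarrow> finsert \<alpha> (finsert \<beta> \<Delta>)) \<Longrightarrow> P (\<Gamma> \<Rrightarrow> \<Delta>)"
    and Neg_Or_right: "sequent_formulas (\<Gamma> \<Rrightarrow> \<Delta>) \<subseteq> F \<Longrightarrow> \<^bold>\<not> (\<alpha> \<^bold>\<or> \<beta>) |\<in>| \<Delta> \<Longrightarrow>
      P (finsert \<alpha> \<Gamma> \<Rrightarrow> \<Delta>) \<Longrightarrow> P (finsert \<beta> \<Gamma> \<Rrightarrow> \<Delta>) \<Longrightarrow> P (\<Gamma> \<Rrightarrow> \<Delta>)"
    and Neg_Imp_left: "sequent_formulas (\<Gamma> \<Rrightarrow> \<Delta>) \<subseteq> F \<Longrightarrow> \<^bold>\<not> (\<alpha> \<^bold>\<rightarrow> \<beta>) |\<in>| \<Gamma> \<Longrightarrow>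
      P (finsert \<alpha> \<Gamma> \<Rrightarrow> finsert \<beta> \<Delta>) \<Longrightarrow> P (\<Gamma> \<Rrightarrow> \<Delta>)"
    and Neg_Imp_right: "sequent_formulas (\<Gamma> \<Rrightarrow> \<Delta>) \<subseteq> F \<Longrightarrow> \<^bold>\<not> (\<alpha> \<^bold>\<rightarrow> \<beta>) |\<in>| \<Delta> \<Longrightarrow>
      P (\<Gamma> \<Rrightarrow> finsert \<alpha> \<Delta>) \<Longrightarrow> P (finsert \<beta> \<Gamma> \<Rrightarrow> \<Delta>) \<Longrightarrow> P (\<Gamma> \<Rrightarrow> \<Delta>)"
begin

abbreviation underivable :: "sequent \<Rightarrow> bool" where
  "underivable T \<equiv> sequent_formulas T \<subseteq> F \<and> \<not> P T"

lemma closedD: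
  "(\<alpha> \<^bold>\<and> \<beta>) \<in> F \<Longrightarrow> \<alpha> \<in> F \<and> \<beta> \<in> F" "(\<alpha> \<^bold>\<or> \<beta>) \<in> F \<Longrightarrow> \<alpha> \<in> F \<and> \<beta> \<in> F"
  "(\<alpha> \<^bold>\<rightarrow> \<beta>) \<in> F \<Longrightarrow> \<alpha> \<in> F \<and> \<beta> \<in> F" "\<^bold>\<not> \<alpha> \<in> F \<Longrightarrow> \<alpha> \<in> F" "\<^bold>\<box> \<alpha> \<in> F \<Longrightarrow> \<alpha> \<in> F"
  "\<^bold>\<diamond> \<alpha> \<in> F \<Longrightarrow> \<alpha> \<in> F"
  by (drule closed, use subformulas_refl in auto)+

text \<open>The engine of saturation: a proper extension within \<open>F\<close> of a maximal
  underivable sequent is derivable, hence available as a premise.\<close>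

lemma maximal_premise:
  assumes "maximal underivable (\<Gamma> \<Rrightarrow> \<Delta>)" "fset \<Gamma>' \<subseteq> F" "fset \<Delta>' \<subseteq> F" "\<not> (\<Gamma>' |\<subseteq>| \<Gamma> \<and> \<Delta>' |\<subseteq>| \<Delta>)"
  shows "P (\<Gamma>' |\<union>| \<Gamma> \<Rrightarrow> \<Delta>' |\<union>| \<Delta>)"
proof (rule ccontr)
  assume "\<not> ?thesis"
  then have "underivable (\<Gamma>' |\<union>| \<Gamma> \<Rrightarrow> \<Delta>' |\<union>| \<Delta>)"
    using assms by (auto simp: maximal_def)
  then have "(\<Gamma>' |\<union>| \<Gamma> \<Rrightarrow> \<Delta>' |\<union>| \<Delta>) = (\<Gamma> \<Rrightarrow> \<Delta>)"
    using assms(1) unfolding maximal_def by fastforce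
  then show False using assms(4) by auto
qed

lemma maximal_premise_left:
  "maximal underivable (\<Gamma> \<Rrightarrow> \<Delta>) \<Longrightarrow> \<alpha> \<in> F \<Longrightarrow> \<alpha> |\<notin>| \<Gamma> \<Longrightarrow> P (finsert \<alpha> \<Gamma> \<Rrightarrow> \<Delta>)"
  using maximal_premise[of \<Gamma> \<Delta> "{|\<alpha>|}" "{||}"] by simp

lemma maximal_premise_right:
  "maximal underivable (\<Gamma> \<Rrightarrow> \<Delta>) \<Longrightarrow> \<alpha> \<in> F \<Longrightarrow> \<alpha> |\<notin>| \<Delta> \<Longrightarrow> P (\<Gamma> \<Rrightarrow> finsert \<alpha> \<Delta>)"
  using maximal_premise[of \<Gamma> \<Delta> "{||}" "{|\<alpha>|}"] by simp

text \<open>If a clause failed, every premise of the corresponding rule would be a proper extension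
  and hence derivable, so the rule would derive the sequent itself. A contained initial sequent
  derives it directly.\<close>

lemma maximal_underivable_saturated:
  assumes max: "maximal underivable (\<Gamma> \<Rrightarrow> \<Delta>)"
  shows "saturated \<Gamma> \<Delta>"
proof -
  have F: "sequent_formulas (\<Gamma> \<Rrightarrow> \<Delta>) \<subseteq> F" and nP: "\<not> P (\<Gamma> \<Rrightarrow> \<Delta>)"
    using max by (auto simp: maximal_def)
  have \<Gamma>: "\<gamma> \<in> F" if "\<gamma> |\<in>| \<Gamma>" for \<gamma> using F that by auto
  have \<Delta>: "\<delta> \<in> F" if "\<delta> |\<in>| \<Delta>" for \<delta> using F that by auto
  note left = maximal_premise_left[OF max] and right = maximal_premise_right[OF max]
  have left2: "P (finsert \<alpha> (finsert \<beta> \<Gamma>) \<Rrightarrow> \<Delta>)" if "\<alpha> \<in> F" "\<beta> \<in> F" "\<not> (\<alpha> |\<in>| \<Gamma> \<and> \<beta> |\<in>| \<Gamma>)" for \<alpha> \<beta>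
    using maximal_premise[OF max, of "{|\<alpha>, \<beta>|}" "{||}"] that by simp
  have right2: "P (\<Gamma> \<Rrightarrow> finsert \<alpha> (finsert \<beta> \<Delta>))" if "\<alpha> \<in> F" "\<beta> \<in> F" "\<not> (\<alpha> |\<in>| \<Delta> \<and> \<beta> |\<in>| \<Delta>)" for \<alpha> \<beta>
    using maximal_premise[OF max, of "{||}" "{|\<alpha>, \<beta>|}"] that by simp
  have both: "P (finsert \<alpha> \<Gamma> \<Rrightarrow> finsert \<beta> \<Delta>)" if "\<alpha> \<in> F" "\<beta> \<in> F" "\<not> (\<alpha> |\<in>| \<Gamma> \<and> \<beta> |\<in>| \<Delta>)" for \<alpha> \<beta>
    using maximal_premise[OF max, of "{|\<alpha>|}" "{|\<beta>|}"] that by simp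
  show ?thesis
    unfolding saturated_def
    apply (intro conjI allI)
    subgoal using nP by (metis init_pos[OF F])
    subgoal using nP by (metis init_neg[OF F])
    subgoal using nP by (metis init_left[OF F])
    subgoal using nP by (metis init_right[OF F])
    subgoal using nP by (metis And_left[OF F] left2 \<Gamma> closedD)
    subgoal using nP by (metis And_right[OF F] right \<Delta> closedD)
    subgoal using nP by (metis Or_left[OF F] left \<Gamma> closedD)
    subgoal using nP by (metis Or_right[OF F] right2 \<Delta> closedD)
    subgoal using nP by (metis Imp_left[OF F] left right \<Gamma> closedD)
    subgoal using nP by (metis Imp_right[OF F] both \<Delta> closedD)
    subgoal using nP by (metis Neg_Neg_left[OF F] left \<Gamma> closedD)
    subgoal using nP by (metis Neg_Neg_right[OF F] right \<Delta> closedD)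
    subgoal using nP by (metis Neg_And_left[OF F] right \<Gamma> closedD)
    subgoal using nP by (metis Neg_And_right[OF F] left2 \<Delta> closedD)
    subgoal using nP by (metis Neg_Or_left[OF F] right2 \<Gamma> closedD)
    subgoal using nP by (metis Neg_Or_right[OF F] left \<Delta> closedD)
    subgoal using nP by (metis Neg_Imp_left[OF F] both \<Gamma> closedD)
    subgoal using nP by (metis Neg_Imp_right[OF F] left right \<Delta> closedD)
    done
qed

end

section \<open>Completeness of gTK and gTKT\<close>

text \<open>Used to strip a modal prefix from a finite set; injectivity of the prefix keeps the
  preimage finite.\<close>

lemma ex_fset_vimage: "inj f \<Longrightarrow> \<exists>A. \<forall>x. x |\<in>| A \<longleftrightarrow> f x |\<in>| B"
proof -
  assume "inj f"
  then have "finite (f -` fset B)" by (simp add: finite_vimageI)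
  then show ?thesis by (intro exI[of _ "Abs_fset (f -` fset B)"]) (simp add: Abs_fset_inverse)
qed

text \<open>Only inclusion of gTK is assumed of \<open>L\<close>, so gTK and gTKT share the
  canonical model; the additional rules of gTKT merely make it reflexive.\<close>

locale gTK_extension =
  fixes L :: "sequent calculus" and F :: "form set"
  assumes incl: "\<And>Ss S. gTK Ss S \<Longrightarrow> L Ss S"
    and finite_F: "finite F" and closed_F: "\<And>\<phi>. \<phi> \<in> F \<Longrightarrow> subformulas \<phi> \<subseteq> F"
begin

abbreviation D :: "sequent \<Rightarrow> bool" where
  "D \<equiv> deriv sequent_formulas L F"

section \<open>Weakening and propositional rules inside \<open>F\<close>\<close>

lemma weaken_left: "D (\<Gamma> \<Rrightarrow> \<Delta>) \<Longrightarrow> fset \<Sigma> \<subseteq> F \<Longrightarrow> D (\<Sigma> |\<union>| \<Gamma> \<Rrightarrow> \<Delta>)"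
proof (induction \<Sigma>)
  case (insert \<alpha> \<Sigma>)
  then have IH: "D (\<Sigma> |\<union>| \<Gamma> \<Rrightarrow> \<Delta>)" by simp
  show ?case
    using deriv_infer1[OF incl[OF gTK.we_left[of _ _ \<alpha>]] IH] deriv_formulas[OF IH] insert.prems by simp
qed simp

lemma weaken_right: "D (\<Gamma> \<Rrightarrow> \<Delta>) \<Longrightarrow> fset \<Pi> \<subseteq> F \<Longrightarrow> D (\<Gamma> \<Rrightarrow> \<Pi> |\<union>| \<Delta>)"
proof (induction \<Pi>)
  case (insert \<alpha> \<Pi>)
  then have IH: "D (\<Gamma> \<Rrightarrow> \<Pi> |\<union>| \<Delta>)" by simp
  show ?case
    using deriv_infer1[OF incl[OF gTK.we_right[of _ _ \<alpha>]] IH] deriv_formulas[OF IH] insert.prems by simp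
qed simp

lemma weaken:
  assumes "D (\<Sigma> \<Rrightarrow> \<Pi>)" "\<Sigma> |\<subseteq>| \<Gamma>" "\<Pi> |\<subseteq>| \<Delta>" "sequent_formulas (\<Gamma> \<Rrightarrow> \<Delta>) \<subseteq> F"
  shows "D (\<Gamma> \<Rrightarrow> \<Delta>)"
proof -
  have "D (\<Gamma> |\<union>| \<Sigma> \<Rrightarrow> \<Delta> |\<union>| \<Pi>)" using assms by (intro weaken_left weaken_right) auto
  moreover have "\<Gamma> |\<union>| \<Sigma> = \<Gamma>" "\<Delta> |\<union>| \<Pi> = \<Delta>" using assms by auto
  ultimately show ?thesis by simp
qed

lemma axiom_weaken:
  "gTK [] (\<Sigma> \<Rrightarrow> \<Pi>) \<Longrightarrow> \<Sigma> |\<subseteq>| \<Gamma> \<Longrightarrow> \<Pi> |\<subseteq>| \<Delta> \<Longrightarrow> sequent_formulas (\<Gamma> \<Rrightarrow> \<Delta>) \<subseteq> F \<Longrightarrow> D (\<Gamma> \<Rrightarrow> \<Delta>)"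
  by (rule weaken[OF deriv_infer0[of L, OF incl]]) auto

lemmas rule1 = deriv_infer1[of L, OF incl] and rule2 = deriv_infer2[of L, OF incl]

text \<open>The principal formula already belongs to the sequent, so \<open>finsert_absorb\<close>
  identifies the conclusion of the rule with the sequent.\<close>

sublocale propositional_closure F D
proof (unfold_locales, goal_cases)
  case 3
  then show ?case by (intro axiom_weaken[OF gTK.init_pos]) auto
next
  case 4
  then show ?case by (intro axiom_weaken[OF gTK.init_neg]) auto
next
  case 5
  then show ?case by (intro axiom_weaken[OF gTK.init_left]) auto
next
  case 6
  then show ?case by (intro axiom_weaken[OF gTK.init_right]) auto
next
  case 7
  show ?case using rule1[OF gTK.And_left 7(3)] 7(1,2) by (simp add: finsert_absorb)
next
  case 8
  show ?case using rule2[OF gTK.And_right 8(3) 8(4)] 8(1,2) by (simp add: finsert_absorb)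
next
  case 9
  show ?case using rule2[OF gTK.Or_left 9(3) 9(4)] 9(1,2) by (simp add: finsert_absorb)
next
  case 10
  show ?case using rule1[OF gTK.Or_right 10(3)] 10(1,2) by (simp add: finsert_absorb)
next
  case 11
  show ?case using rule2[OF gTK.Imp_left 11(3) 11(4)] 11(1,2) by (simp add: finsert_absorb)
next
  case 12
  show ?case using rule1[OF gTK.Imp_right 12(3)] 12(1,2) by (simp add: finsert_absorb)
next
  case 13
  show ?case using rule1[OF gTK.Neg_Neg_left 13(3)] 13(1,2) by (simp add: finsert_absorb)
next
  case 14
  show ?case using rule1[OF gTK.Neg_Neg_right 14(3)] 14(1,2) by (simp add: finsert_absorb)
next
  case 15
  show ?case using rule2[OF gTK.Neg_And_left 15(3) 15(4)] 15(1,2) by (simp add: finsert_absorb)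
next
  case 16
  show ?case using rule1[OF gTK.Neg_And_right 16(3)] 16(1,2) by (simp add: finsert_absorb)
next
  case 17
  show ?case using rule1[OF gTK.Neg_Or_left 17(3)] 17(1,2) by (simp add: finsert_absorb)
next
  case 18
  show ?case using rule2[OF gTK.Neg_Or_right 18(3) 18(4)] 18(1,2) by (simp add: finsert_absorb)
next
  case 19
  show ?case using rule1[OF gTK.Neg_Imp_left 19(3)] 19(1,2) by (simp add: finsert_absorb)
next
  case 20
  show ?case using rule2[OF gTK.Neg_Imp_right 20(3) 20(4)] 20(1,2) by (simp add: finsert_absorb)
qed (use finite_F closed_F in auto)

text \<open>The canonical relation, read off from the contexts of the K rules. Requiring a maximal
  target keeps every successor a world.\<close>

definition accessible :: "sequent \<Rightarrow> sequent \<Rightarrow> bool" where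
  "accessible w v \<longleftrightarrow> maximal underivable v \<and>
    (\<forall>\<alpha>. \<^bold>\<box> \<alpha> |\<in>| antecedent w \<or> \<^bold>\<not> \<^bold>\<box> \<alpha> |\<in>| succedent w \<longrightarrow> \<alpha> |\<in>| antecedent v) \<and>
    (\<forall>\<alpha>. \<^bold>\<diamond> \<alpha> |\<in>| succedent w \<or> \<^bold>\<not> \<^bold>\<diamond> \<alpha> |\<in>| antecedent w \<longrightarrow> \<alpha> |\<in>| succedent v)"

text \<open>The universal clauses are built into \<open>accessible\<close>. For an existential
  clause the premise of the K rule must be underivable, otherwise the rule and weakening would
  derive \<open>w\<close>; a maximal extension of that premise is the successor.\<close>

lemma underivable_modal_saturated:
  assumes w: "underivable w"
  shows "modal_saturated accessible w"
proof -
  obtain \<Gamma> \<Delta> where w_eq: "w = (\<Gamma> \<Rrightarrow> \<Delta>)" by (cases w)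
  \<comment> \<open>These four sets form the largest K context whose conclusion still fits inside
    \<open>w\<close>.\<close>
  obtain \<Gamma>\<^sub>1 where \<Gamma>\<^sub>1: "\<And>\<alpha>. \<alpha> |\<in>| \<Gamma>\<^sub>1 \<longleftrightarrow> \<^bold>\<box> \<alpha> |\<in>| \<Gamma>"
    using ex_fset_vimage[of Box \<Gamma>] by (auto simp: inj_def)
  obtain \<Gamma>\<^sub>2 where \<Gamma>\<^sub>2: "\<And>\<alpha>. \<alpha> |\<in>| \<Gamma>\<^sub>2 \<longleftrightarrow> \<^bold>\<not> \<^bold>\<diamond> \<alpha> |\<in>| \<Gamma>"
    using ex_fset_vimage[of "\<lambda>\<alpha>. \<^bold>\<not> \<^bold>\<diamond> \<alpha>" \<Gamma>] by (auto simp: inj_def)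
  obtain \<Delta>\<^sub>1 where \<Delta>\<^sub>1: "\<And>\<alpha>. \<alpha> |\<in>| \<Delta>\<^sub>1 \<longleftrightarrow> \<^bold>\<diamond> \<alpha> |\<in>| \<Delta>"
    using ex_fset_vimage[of Dia \<Delta>] by (auto simp: inj_def)
  obtain \<Delta>\<^sub>2 where \<Delta>\<^sub>2: "\<And>\<alpha>. \<alpha> |\<in>| \<Delta>\<^sub>2 \<longleftrightarrow> \<^bold>\<not> \<^bold>\<box> \<alpha> |\<in>| \<Delta>"
    using ex_fset_vimage[of "\<lambda>\<alpha>. \<^bold>\<not> \<^bold>\<box> \<alpha>" \<Delta>] by (auto simp: inj_def)
  have F: "fset \<Gamma> \<subseteq> F" "fset \<Delta> \<subseteq> F" and nD: "\<not> D (\<Gamma> \<Rrightarrow> \<Delta>)" using w w_eq by auto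
  have sub: "fset \<Gamma>\<^sub>1 \<subseteq> F" "fset \<Gamma>\<^sub>2 \<subseteq> F" "fset \<Delta>\<^sub>1 \<subseteq> F" "fset \<Delta>\<^sub>2 \<subseteq> F"
    using F \<Gamma>\<^sub>1 \<Gamma>\<^sub>2 \<Delta>\<^sub>1 \<Delta>\<^sub>2 closedD by blast+
  have ctx: "Boxs \<Gamma>\<^sub>1 |\<union>| NegDias \<Gamma>\<^sub>2 |\<subseteq>| \<Gamma>" "Dias \<Delta>\<^sub>1 |\<union>| NegBoxs \<Delta>\<^sub>2 |\<subseteq>| \<Delta>"
    using \<Gamma>\<^sub>1 \<Gamma>\<^sub>2 \<Delta>\<^sub>1 \<Delta>\<^sub>2 by auto
  have successor: "\<exists>v. accessible w v \<and> \<Sigma> |\<subseteq>| antecedent v \<and> \<Pi> |\<subseteq>| succedent v"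
    if "\<not> D (\<Sigma> \<Rrightarrow> \<Pi>)" "fset \<Sigma> \<subseteq> F" "fset \<Pi> \<subseteq> F" "\<Gamma>\<^sub>1 |\<union>| \<Delta>\<^sub>2 |\<subseteq>| \<Sigma>" "\<Delta>\<^sub>1 |\<union>| \<Gamma>\<^sub>2 |\<subseteq>| \<Pi>" for \<Sigma> \<Pi>
  proof -
    have "underivable (\<Sigma> \<Rrightarrow> \<Pi>)" using that by simp
    then obtain v where v: "extends (\<Sigma> \<Rrightarrow> \<Pi>) v" "maximal underivable v"
      using maximal_extension[OF fin, of underivable] by blast
    then have "\<Gamma>\<^sub>1 |\<union>| \<Delta>\<^sub>2 |\<subseteq>| antecedent v" "\<Delta>\<^sub>1 |\<union>| \<Gamma>\<^sub>2 |\<subseteq>| succedent v"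
      using that(4,5) by auto
    then have "accessible w v"
      using v(2) \<Gamma>\<^sub>1 \<Gamma>\<^sub>2 \<Delta>\<^sub>1 \<Delta>\<^sub>2 unfolding accessible_def w_eq by auto
    then show ?thesis using v(1) by auto
  qed
  have ctxF: "fset (Boxs \<Gamma>\<^sub>1 |\<union>| NegDias \<Gamma>\<^sub>2) \<subseteq> F" "fset (Dias \<Delta>\<^sub>1 |\<union>| NegBoxs \<Delta>\<^sub>2) \<subseteq> F"
    using ctx F by auto
  \<comment> \<open>\<open>Box_K_right\<close> and \<open>Neg_Box_K_left\<close> have the same
    premise, so one successor handles both cases; \<open>left\<close> treats the other pair of rules
    likewise.\<close>
  have right: "\<exists>v. accessible w v \<and> \<alpha> |\<in>| succedent v" if "\<^bold>\<box> \<alpha> |\<in>| \<Delta> \<or> \<^bold>\<not> \<^bold>\<box> \<alpha> |\<in>| \<Gamma>" for \<alpha>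
  proof -
    have "\<alpha> \<in> F" using that F closedD by blast
    moreover have "\<not> D (\<Gamma>\<^sub>1 |\<union>| \<Delta>\<^sub>2 \<Rrightarrow> finsert \<alpha> (\<Delta>\<^sub>1 |\<union>| \<Gamma>\<^sub>2))"
    proof
      assume prem: "D (\<Gamma>\<^sub>1 |\<union>| \<Delta>\<^sub>2 \<Rrightarrow> finsert \<alpha> (\<Delta>\<^sub>1 |\<union>| \<Gamma>\<^sub>2))"
      from that show False
      proof
        assume in\<Delta>: "\<^bold>\<box> \<alpha> |\<in>| \<Delta>"
        show False
          by (rule notE[OF nD], rule weaken[OF rule1[OF gTK.Box_K_right prem]])
            (use in\<Delta> ctx ctxF F in auto)
      next
        assume in\<Gamma>: "\<^bold>\<not> \<^bold>\<box> \<alpha> |\<in>| \<Gamma>"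
        show False
          by (rule notE[OF nD], rule weaken[OF rule1[OF gTK.Neg_Box_K_left prem]])
            (use in\<Gamma> ctx ctxF F in auto)
      qed
    qed
    ultimately show ?thesis
      using successor[of "\<Gamma>\<^sub>1 |\<union>| \<Delta>\<^sub>2" "finsert \<alpha> (\<Delta>\<^sub>1 |\<union>| \<Gamma>\<^sub>2)"] sub by auto
  qed
  have left: "\<exists>v. accessible w v \<and> \<alpha> |\<in>| antecedent v" if "\<^bold>\<diamond> \<alpha> |\<in>| \<Gamma> \<or> \<^bold>\<not> \<^bold>\<diamond> \<alpha> |\<in>| \<Delta>" for \<alpha>
  proof -
    have "\<alpha> \<in> F" using that F closedD by blast
    moreover have "\<not> D (finsert \<alpha> (\<Gamma>\<^sub>1 |\<union>| \<Delta>\<^sub>2) \<Rrightarrow> \<Delta>\<^sub>1 |\<union>| \<Gamma>\<^sub>2)"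
    proof
      assume prem: "D (finsert \<alpha> (\<Gamma>\<^sub>1 |\<union>| \<Delta>\<^sub>2) \<Rrightarrow> \<Delta>\<^sub>1 |\<union>| \<Gamma>\<^sub>2)"
      from that show False
      proof
        assume in\<Gamma>: "\<^bold>\<diamond> \<alpha> |\<in>| \<Gamma>"
        show False
          by (rule notE[OF nD], rule weaken[OF rule1[OF gTK.Dia_K_left prem]])
            (use in\<Gamma> ctx ctxF F in auto)
      next
        assume in\<Delta>: "\<^bold>\<not> \<^bold>\<diamond> \<alpha> |\<in>| \<Delta>"
        show False
          by (rule notE[OF nD], rule weaken[OF rule1[OF gTK.Neg_Dia_K_right prem]])
            (use in\<Delta> ctx ctxF F in auto)
      qed
    qed
    ultimately show ?thesis
      using successor[of "finsert \<alpha> (\<Gamma>\<^sub>1 |\<union>| \<Delta>\<^sub>2)" "\<Delta>\<^sub>1 |\<union>| \<Gamma>\<^sub>2"] sub by auto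
  qed
  show ?thesis
    using left right unfolding modal_saturated_def w_eq by (simp add: accessible_def)
qed

lemma countermodel:
  assumes "sequent_formulas S \<subseteq> F" "\<not> D S"
  obtains w where "maximal underivable w" "\<not> holds_seq accessible canonical_val w S"
proof -
  obtain w where w: "extends S w" "maximal underivable w"
    using maximal_extension[OF fin, of underivable S] assms by blast
  have "\<not> holds_seq accessible canonical_val w S"
  proof (rule canonical_refutes[where W = "Collect (maximal underivable)"])
    show "saturated (antecedent v) (succedent v)" if "v \<in> Collect (maximal underivable)" for v
      using that maximal_underivable_saturated by (cases v) simp
    show "modal_saturated accessible v" if "v \<in> Collect (maximal underivable)" for v
      using that underivable_modal_saturated by (simp add: maximal_def)
  qed (use w in \<open>simp_all add: accessible_def\<close>)
  then show ?thesis using that w by blast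
qed

end

text \<open>Soundness of the unrestricted calculus makes \<open>S\<close> true throughout the
  canonical model, against \<open>countermodel\<close>. This is how formulas outside
  \<open>F\<close>, such as those introduced by cut, are eliminated.\<close>

lemma gTK_complete:
  assumes "finite F" "\<And>\<phi>. \<phi> \<in> F \<Longrightarrow> subformulas \<phi> \<subseteq> F" "sequent_formulas S \<subseteq> F" "provable gTK S"
  shows "deriv sequent_formulas gTK F S"
proof (rule ccontr)
  assume nD: "\<not> ?thesis"
  interpret gTK_extension gTK F by unfold_locales (use assms in auto)
  let ?W = "Collect (maximal underivable)"
  obtain w where w: "w \<in> ?W" "\<not> holds_seq accessible canonical_val w S"
    using countermodel[OF assms(3) nD] by blast
  have "\<forall>w\<in>?W. holds_seq accessible canonical_val w S"
    using assms(4)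
  proof (rule provable_sound)
    show "\<forall>w\<in>?W. holds_seq accessible canonical_val w S"
      if "gTK Ss S" "\<And>T. T \<in> set Ss \<Longrightarrow> \<forall>w\<in>?W. holds_seq accessible canonical_val w T" for Ss S
      by (rule gTK_sound[OF that(1)]) (use that(2) in \<open>auto simp: accessible_def\<close>)
  qed
  with w show False by blast
qed

lemma gTKT_complete:
  assumes "finite F" "\<And>\<phi>. \<phi> \<in> F \<Longrightarrow> subformulas \<phi> \<subseteq> F" "sequent_formulas S \<subseteq> F" "provable gTKT S"
  shows "deriv sequent_formulas gTKT F S"
proof (rule ccontr)
  assume nD: "\<not> ?thesis"
  interpret gTK_extension gTKT F by unfold_locales (use assms in \<open>auto intro: gTKT.gTK\<close>)
  let ?W = "Collect (maximal underivable)"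
  obtain w where w: "w \<in> ?W" "\<not> holds_seq accessible canonical_val w S"
    using countermodel[OF assms(3) nD] by blast
  \<comment> \<open>If \<open>\<alpha>\<close> were missing, maximality would derive the premise of
    the matching additional rule, and that rule, with its principal formula already present, would
    derive \<open>v\<close>.\<close>
  have refl: "accessible v v" if max: "maximal underivable v" for v
  proof (cases v)
    case (Sequent \<Gamma> \<Delta>)
    have F: "fset \<Gamma> \<subseteq> F" "fset \<Delta> \<subseteq> F" and nD: "\<not> D (\<Gamma> \<Rrightarrow> \<Delta>)"
      using max Sequent by (auto simp: maximal_def)
    note left = maximal_premise_left[OF max[unfolded Sequent]]
      and right = maximal_premise_right[OF max[unfolded Sequent]]
    have "\<alpha> |\<in>| \<Gamma>" if "\<^bold>\<box> \<alpha> |\<in>| \<Gamma>" for \<alpha>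
    proof (rule ccontr)
      assume "\<alpha> |\<notin>| \<Gamma>"
      then have "D (finsert \<alpha> \<Gamma> \<Rrightarrow> \<Delta>)" using left closedD(5) that F by blast
      from deriv_infer1[of gTKT, OF gTKT.Box_left this] that nD F show False
        by (simp add: finsert_absorb)
    qed
    moreover have "\<alpha> |\<in>| \<Delta>" if "\<^bold>\<diamond> \<alpha> |\<in>| \<Delta>" for \<alpha>
    proof (rule ccontr)
      assume "\<alpha> |\<notin>| \<Delta>"
      then have "D (\<Gamma> \<Rrightarrow> finsert \<alpha> \<Delta>)" using right closedD(6) that F by blast
      from deriv_infer1[of gTKT, OF gTKT.Dia_right this] that nD F show False
        by (simp add: finsert_absorb)
    qed
    moreover have "\<alpha> |\<in>| \<Gamma>" if "\<^bold>\<not> \<^bold>\<box> \<alpha> |\<in>| \<Delta>" for \<alpha>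
    proof (rule ccontr)
      assume "\<alpha> |\<notin>| \<Gamma>"
      then have "D (finsert \<alpha> \<Gamma> \<Rrightarrow> \<Delta>)" using left closedD(4,5) that F by blast
      from deriv_infer1[of gTKT, OF gTKT.Neg_Box_right this] that nD F show False
        by (simp add: finsert_absorb)
    qed
    moreover have "\<alpha> |\<in>| \<Delta>" if "\<^bold>\<not> \<^bold>\<diamond> \<alpha> |\<in>| \<Gamma>" for \<alpha>
    proof (rule ccontr)
      assume "\<alpha> |\<notin>| \<Delta>"
      then have "D (\<Gamma> \<Rrightarrow> finsert \<alpha> \<Delta>)" using right closedD(4,6) that F by blast
      from deriv_infer1[of gTKT, OF gTKT.Neg_Dia_left this] that nD F show False
        by (simp add: finsert_absorb)
    qed
    ultimately show ?thesis using max unfolding accessible_def Sequent antecedent.simps succedent.simps by blast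
  qed
  have "\<forall>w\<in>?W. holds_seq accessible canonical_val w S"
    using assms(4)
  proof (rule provable_sound)
    show "\<forall>w\<in>?W. holds_seq accessible canonical_val w S"
      if "gTKT Ss S" "\<And>T. T \<in> set Ss \<Longrightarrow> \<forall>w\<in>?W. holds_seq accessible canonical_val w T" for Ss S
    proof (rule gTKT_sound[OF that(1)])
      show "\<forall>T\<in>set Ss. \<forall>w\<in>?W. holds_seq accessible canonical_val w T" using that(2) by blast
    qed (simp_all add: refl, simp add: accessible_def)
  qed
  with w show False by blast
qed

section \<open>Completeness of HTS5\<close>

lemma hypersequent_formulas_simps [simp]:
  "hypersequent_formulas {#} = {}"
  "hypersequent_formulas (add_mset S H) = sequent_formulas S \<union> hypersequent_formulas H"
  "hypersequent_formulas (H + G) = hypersequent_formulas H \<union> hypersequent_formulas G"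
  by (auto simp: hypersequent_formulas_def)

text \<open>Finiteness lets a set of sequents over \<open>F\<close> be read as a hypersequent and be
  chosen maximal.\<close>

lemma finite_sequents:
  assumes "finite F"
  shows "finite {S. sequent_formulas S \<subseteq> F}"
proof -
  let ?A = "{\<Gamma>. fset \<Gamma> \<subseteq> F}"
  have "finite (fset ` ?A)" using assms by (auto intro: finite_subset[of _ "Pow F"])
  then have "finite ?A" by (rule finite_imageD) (simp add: inj_on_def fset_inject)
  moreover have "{S. sequent_formulas S \<subseteq> F} \<subseteq> (\<lambda>(\<Gamma>, \<Delta>). \<Gamma> \<Rrightarrow> \<Delta>) ` (?A \<times> ?A)"
  proof
    fix S assume "S \<in> {S. sequent_formulas S \<subseteq> F}"
    then show "S \<in> (\<lambda>(\<Gamma>, \<Delta>). \<Gamma> \<Rrightarrow> \<Delta>) ` (?A \<times> ?A)" by (cases S) auto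
  qed
  ultimately show ?thesis by (meson finite_SigmaI finite_imageI finite_subset)
qed

locale HTS5_analytic =
  fixes F :: "form set"
  assumes finite_F: "finite F" and closed_F: "\<And>\<phi>. \<phi> \<in> F \<Longrightarrow> subformulas \<phi> \<subseteq> F" and nonempty_F: "F \<noteq> {}"
begin

abbreviation D :: "hypersequent \<Rightarrow> bool" where
  "D \<equiv> deriv hypersequent_formulas HTS5 F"

lemmas rule1 = deriv_infer1[of HTS5] and rule2 = deriv_infer2[of HTS5]

text \<open>Since both sides of a sequent are sets, merging a component with a copy of itself is
  external contraction.\<close>

lemma contract: "D (H + G) \<Longrightarrow> set_mset H \<subseteq> set_mset G \<Longrightarrow> D G"
proof (induction H)
  case (add S H)
  then obtain G' where G: "G = add_mset S G'" by (metis insert_DiffM set_mset_add_mset_insert insert_subset)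
  obtain \<Gamma> \<Delta> where S: "S = (\<Gamma> \<Rrightarrow> \<Delta>)" by (cases S)
  have prem: "D ({#\<Gamma> \<Rrightarrow> \<Delta>, \<Gamma> \<Rrightarrow> \<Delta>#} + (H + G'))" using add.prems(1) by (simp add: G S)
  have "D (H + G)"
    using rule1[OF HTS5.merge prem] deriv_formulas[OF prem] by (simp add: G S)
  then show ?case using add by auto
qed simp

text \<open>
  External weakening by the empty sequent is not a rule: it is obtained by cutting two
  one-formula external weakenings against each other.
\<close>

lemma weaken_empty:
  assumes "D H"
  shows "D ({#{||} \<Rrightarrow> {||}#} + H)"
proof -
  obtain \<alpha> where \<alpha>: "\<alpha> \<in> F" using nonempty_F by blast
  have H: "hypersequent_formulas H \<subseteq> F" by (rule deriv_formulas[OF assms])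
  have "D ({#{||} \<Rrightarrow> finsert \<alpha> {||}#} + H)"
    by (rule rule1[OF HTS5.ex_we_right assms]) (use \<alpha> H in simp)
  moreover have "D ({#finsert \<alpha> {||} \<Rrightarrow> {||}#} + H)"
    by (rule rule1[OF HTS5.ex_we_left assms]) (use \<alpha> H in simp)
  ultimately have "D ({#{||} |\<union>| {||} \<Rrightarrow> {||} |\<union>| {||}#} + H + H)"
    by (rule rule2[OF HTS5.cut]) (use H in simp)
  then have "D (H + ({#{||} \<Rrightarrow> {||}#} + H))" by (simp add: ac_simps)
  then show ?thesis by (rule contract) auto
qed

lemma weaken_left:
  "D ({#\<Gamma> \<Rrightarrow> \<Delta>#} + H) \<Longrightarrow> fset \<Sigma> \<subseteq> F \<Longrightarrow> D ({#\<Sigma> |\<union>| \<Gamma> \<Rrightarrow> \<Delta>#} + H)"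
proof (induction \<Sigma>)
  case (insert \<alpha> \<Sigma>)
  then have IH: "D ({#\<Sigma> |\<union>| \<Gamma> \<Rrightarrow> \<Delta>#} + H)" by simp
  show ?case
    using rule1[OF HTS5.in_we_left[of _ _ _ \<alpha>] IH] deriv_formulas[OF IH] insert.prems by simp
qed simp

lemma weaken_right:
  "D ({#\<Gamma> \<Rrightarrow> \<Delta>#} + H) \<Longrightarrow> fset \<Pi> \<subseteq> F \<Longrightarrow> D ({#\<Gamma> \<Rrightarrow> \<Pi> |\<union>| \<Delta>#} + H)"
proof (induction \<Pi>)
  case (insert \<alpha> \<Pi>)
  then have IH: "D ({#\<Gamma> \<Rrightarrow> \<Pi> |\<union>| \<Delta>#} + H)" by simp
  show ?case
    using rule1[OF HTS5.in_we_right[of _ _ _ \<alpha>] IH] deriv_formulas[OF IH] insert.prems by simp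
qed simp

lemma weaken_component:
  assumes "D ({#S#} + H)" "extends S T" "sequent_formulas T \<subseteq> F"
  shows "D ({#T#} + H)"
proof -
  obtain \<Sigma> \<Pi> \<Gamma> \<Delta> where ST: "S = (\<Sigma> \<Rrightarrow> \<Pi>)" "T = (\<Gamma> \<Rrightarrow> \<Delta>)" by (cases S, cases T)
  have "D ({#\<Gamma> |\<union>| \<Sigma> \<Rrightarrow> \<Delta> |\<union>| \<Pi>#} + H)" using assms ST by (intro weaken_left weaken_right) auto
  moreover have "\<Gamma> |\<union>| \<Sigma> = \<Gamma>" "\<Delta> |\<union>| \<Pi> = \<Delta>" using assms ST by auto
  ultimately show ?thesis using ST by simp
qed

text \<open>A component is added as the empty sequent and then filled by internal weakening.\<close>

lemma weaken_external: "D H \<Longrightarrow> hypersequent_formulas G \<subseteq> F \<Longrightarrow> D (H + G)"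
proof (induction G)
  case (add S G)
  then have "D ({#{||} \<Rrightarrow> {||}#} + (H + G))" by (intro weaken_empty) simp
  then have "D ({#S#} + (H + G))" by (rule weaken_component) (use add.prems in simp_all)
  then show ?case by simp
qed simp

text \<open>Inside \<open>F\<close>, derivability therefore depends only on the set of components
  and is monotone in it.\<close>

lemma structural:
  "D H \<Longrightarrow> set_mset H \<subseteq> set_mset G \<Longrightarrow> hypersequent_formulas G \<subseteq> F \<Longrightarrow> D G"
  by (rule contract[OF weaken_external])

text \<open>Two-premise rules join the side hypersequents of their premises; this removes the
  duplicate when both are \<open>G\<close>.\<close>

lemma contract_side: "D ({#S#} + G + G) \<Longrightarrow> D ({#S#} + G)"
  using structural[of "{#S#} + G + G" "{#S#} + G"] deriv_formulas[of hypersequent_formulas HTS5 F "{#S#} + G + G"] by auto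

lemma axiom_weaken:
  assumes "HTS5 [] {#S#}" "extends S T" "sequent_formulas T \<subseteq> F" "hypersequent_formulas G \<subseteq> F"
  shows "D ({#T#} + G)"
proof (rule weaken_component[OF weaken_external])
  show "D {#S#}"
    using assms by (intro deriv_infer0) (auto simp: sequent_formulas_eq extends_def)
qed (use assms in auto)

lemma propositional_closure_side:
  assumes G: "hypersequent_formulas G \<subseteq> F"
  shows "propositional_closure F (\<lambda>S. D ({#S#} + G))"
proof (unfold_locales, goal_cases)
  case 3
  then show ?case using G by (intro axiom_weaken[OF HTS5.init_pos]) auto
next
  case 4
  then show ?case using G by (intro axiom_weaken[OF HTS5.init_neg]) auto
next
  case 5
  then show ?case using G by (intro axiom_weaken[OF HTS5.init_left]) auto
next
  case 6
  then show ?case using G by (intro axiom_weaken[OF HTS5.init_right]) auto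
next
  case 7
  show ?case using rule1[OF HTS5.And_left 7(3)] 7(1,2) G by (simp add: finsert_absorb)
next
  case 8
  show ?case
    using rule2[OF HTS5.And_right 8(3) 8(4)] 8(1,2) G by (intro contract_side) (simp add: finsert_absorb)
next
  case 9
  show ?case
    using rule2[OF HTS5.Or_left 9(3) 9(4)] 9(1,2) G by (intro contract_side) (simp add: finsert_absorb)
next
  case 10
  show ?case using rule1[OF HTS5.Or_right 10(3)] 10(1,2) G by (simp add: finsert_absorb)
next
  case 11
  show ?case
    using rule2[OF HTS5.Imp_left 11(3) 11(4)] 11(1,2) G by (intro contract_side) (simp add: finsert_absorb)
next
  case 12
  show ?case using rule1[OF HTS5.Imp_right 12(3)] 12(1,2) G by (simp add: finsert_absorb)
next
  case 13
  show ?case using rule1[OF HTS5.Neg_Neg_left 13(3)] 13(1,2) G by (simp add: finsert_absorb)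
next
  case 14
  show ?case using rule1[OF HTS5.Neg_Neg_right 14(3)] 14(1,2) G by (simp add: finsert_absorb)
next
  case 15
  show ?case
    using rule2[OF HTS5.Neg_And_left 15(3) 15(4)] 15(1,2) G by (intro contract_side) (simp add: finsert_absorb)
next
  case 16
  show ?case using rule1[OF HTS5.Neg_And_right 16(3)] 16(1,2) G by (simp add: finsert_absorb)
next
  case 17
  show ?case using rule1[OF HTS5.Neg_Or_left 17(3)] 17(1,2) G by (simp add: finsert_absorb)
next
  case 18
  show ?case
    using rule2[OF HTS5.Neg_Or_right 18(3) 18(4)] 18(1,2) G by (intro contract_side) (simp add: finsert_absorb)
next
  case 19
  show ?case using rule1[OF HTS5.Neg_Imp_left 19(3)] 19(1,2) G by (simp add: finsert_absorb)
next
  case 20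
  show ?case
    using rule2[OF HTS5.Neg_Imp_right 20(3) 20(4)] 20(1,2) G by (intro contract_side) (simp add: finsert_absorb)
qed (use finite_F closed_F in auto)

text \<open>A single universal model must refute all components, though possibly at different
  worlds. Hence the components of \<open>H\<close> are put into one maximal set, each member of
  which lies below a world.\<close>

lemma countermodel:
  assumes S: "hypersequent_formulas H \<subseteq> F" "\<not> D H"
  obtains W where "\<And>S. S \<in># H \<Longrightarrow> \<exists>w\<in>W. \<not> holds_seq (\<lambda>_ v. v \<in> W) canonical_val w S"
proof -
  define U where "U = {S. sequent_formulas S \<subseteq> F}"
  have U: "finite U" unfolding U_def by (rule finite_sequents[OF finite_F])
  define \<X> where "\<X> = {X. X \<subseteq> U \<and> set_mset H \<subseteq> X \<and> \<not> D (mset_set X)}"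
  have "finite \<X>" unfolding \<X>_def using U by (auto intro: finite_subset[of _ "Pow U"])
  \<comment> \<open>Forgetting multiplicities keeps \<open>H\<close> underivable, by
    \<open>structural\<close>.\<close>
  moreover have "set_mset H \<in> \<X>"
    using S structural[of "mset_set (set_mset H)" H] by (auto simp: \<X>_def U_def hypersequent_formulas_def)
  ultimately obtain X where X: "X \<in> \<X>" and max: "\<And>Y. Y \<in> \<X> \<Longrightarrow> X \<subseteq> Y \<Longrightarrow> X = Y"
    using finite_has_maximal[of \<X>] by blast
  define G where "G = mset_set X"
  have nD: "\<not> D G" and XU: "X \<subseteq> U" and HX: "set_mset H \<subseteq> X" using X by (auto simp: \<X>_def G_def)
  have finX: "finite X" using XU U by (rule finite_subset)
  have setG: "set_mset G = X" using finX by (simp add: G_def)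
  have GF: "hypersequent_formulas G \<subseteq> F"
    using XU by (auto simp: setG hypersequent_formulas_def U_def)
  \<comment> \<open>Members of \<open>X\<close> are already components of \<open>G\<close>, so
    further copies contract away.\<close>
  have drop: "\<not> D ({#S#} + G)" "\<not> D ({#S#} + ({#T#} + G))" if "S \<in> X" "T \<in> X" for S T
    using nD GF that structural[of "{#S#} + G" G] structural[of "{#S#} + ({#T#} + G)" G]
    by (auto simp: setG)
  interpret propositional_closure F "\<lambda>S. D ({#S#} + G)"
    by (rule propositional_closure_side[OF GF])
  have X_iff: "S \<in> X \<longleftrightarrow> underivable S" for S
  proof
    assume "S \<in> X" then show "underivable S" using drop XU by (auto simp: U_def)
  next
    assume S: "underivable S"
    show "S \<in> X"
    proof (rule ccontr)
      assume "S \<notin> X"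
      then have "insert S X \<notin> \<X>" using max[of "insert S X"] by blast
      then have "D (mset_set (insert S X))" using XU HX S by (auto simp: \<X>_def U_def)
      then have "D ({#S#} + G)"
        by (rule structural) (use S GF finX in \<open>auto simp: setG\<close>)
      then show False using S by blast
    qed
  qed
  define W where "W = Collect (maximal underivable)"
  have WX: "w \<in> X" if "w \<in> W" for w using that by (simp add: W_def maximal_def X_iff)
  have WF: "sequent_formulas w \<subseteq> F" if "w \<in> W" for w using that by (simp add: W_def maximal_def)
  have above: "\<exists>w\<in>W. extends S w" if "S \<in> X" for S
    using maximal_extension[OF finite_F, of underivable S] that by (auto simp: X_iff W_def)
  have sat: "saturated (antecedent w) (succedent w)" if "w \<in> W" for w
    using that maximal_underivable_saturated by (cases w) (simp add: W_def)
  \<comment> \<open>Contrapositive use of a rule leading from the component \<open>T\<close> to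
    \<open>S\<close>: otherwise \<open>S\<close>, weakened to \<open>w\<close>, would be derivable
    next to \<open>G\<close>.\<close>
  have inX: "T \<in> X" if "w \<in> W" "extends S w" "sequent_formulas T \<subseteq> F" "D ({#T#} + G) \<Longrightarrow> D ({#S#} + G)" for w S T
  proof (rule ccontr)
    assume "T \<notin> X"
    then have "D ({#S#} + G)" using that by (auto simp: X_iff)
    then have "D ({#w#} + G)" by (rule weaken_component) (use that WX XU in \<open>auto simp: U_def\<close>)
    then show False using drop WX that(1) by blast
  qed
  \<comment> \<open>For rules that split off a new component: \<open>w\<close> absorbs
    \<open>S\<close>, and both worlds are already in \<open>G\<close>.\<close>
  have inW: "False" if "w \<in> W" "v \<in> W" "extends S w" "D ({#S, v#} + G)" for w v S
  proof -
    have "D ({#w#} + ({#v#} + G))"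
      by (rule weaken_component[of S]) (use that WX XU in \<open>auto simp: U_def add_mset_commute\<close>)
    then show False using drop WX that by blast
  qed
  have modal: "modal_saturated (\<lambda>_ v. v \<in> W) w" if w: "w \<in> W" for w
  proof -
    obtain \<Gamma> \<Delta> where w_eq: "w = (\<Gamma> \<Rrightarrow> \<Delta>)" by (cases w)
    have F: "fset \<Gamma> \<subseteq> F" "fset \<Delta> \<subseteq> F" using WF[OF w] by (simp_all add: w_eq)
    \<comment> \<open>The active premise component lies in \<open>X\<close> by \<open>inX\<close>,
      and any world above it is the required witness.\<close>
    have ex_right: "\<exists>v. v \<in> W \<and> \<alpha> |\<in>| succedent v" if "\<^bold>\<box> \<alpha> |\<in>| \<Delta> \<or> \<^bold>\<not> \<^bold>\<box> \<alpha> |\<in>| \<Gamma>" for \<alpha>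
    proof -
      have \<alpha>: "\<alpha> \<in> F" using that F closedD by blast
      from that have "({||} \<Rrightarrow> {|\<alpha>|}) \<in> X"
      proof
        assume "\<^bold>\<box> \<alpha> |\<in>| \<Delta>"
        then show ?thesis
          by (intro inX[OF w, of "{||} \<Rrightarrow> {|\<^bold>\<box> \<alpha>|}"], simp_all only: w_eq)
            (use F \<alpha> GF rule1[OF HTS5.Box_right[of \<alpha> G]] in auto)
      next
        assume "\<^bold>\<not> \<^bold>\<box> \<alpha> |\<in>| \<Gamma>"
        then show ?thesis
          by (intro inX[OF w, of "{|\<^bold>\<not> \<^bold>\<box> \<alpha>|} \<Rrightarrow> {||}"], simp_all only: w_eq)
            (use F \<alpha> GF rule1[OF HTS5.Neg_Box_S5_left[of \<alpha> G]] in auto)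
      qed
      from above[OF this] show ?thesis by auto
    qed
    have ex_left: "\<exists>v. v \<in> W \<and> \<alpha> |\<in>| antecedent v" if "\<^bold>\<diamond> \<alpha> |\<in>| \<Gamma> \<or> \<^bold>\<not> \<^bold>\<diamond> \<alpha> |\<in>| \<Delta>" for \<alpha>
    proof -
      have \<alpha>: "\<alpha> \<in> F" using that F closedD by blast
      from that have "({|\<alpha>|} \<Rrightarrow> {||}) \<in> X"
      proof
        assume "\<^bold>\<diamond> \<alpha> |\<in>| \<Gamma>"
        then show ?thesis
          by (intro inX[OF w, of "{|\<^bold>\<diamond> \<alpha>|} \<Rrightarrow> {||}"], simp_all only: w_eq)
            (use F \<alpha> GF rule1[OF HTS5.Dia_left[of \<alpha> G]] in auto)
      next
        assume "\<^bold>\<not> \<^bold>\<diamond> \<alpha> |\<in>| \<Delta>"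
        then show ?thesis
          by (intro inX[OF w, of "{||} \<Rrightarrow> {|\<^bold>\<not> \<^bold>\<diamond> \<alpha>|}"], simp_all only: w_eq)
            (use F \<alpha> GF rule1[OF HTS5.Neg_Dia_S5_right[of \<alpha> G]] in auto)
      qed
      from above[OF this] show ?thesis by auto
    qed
    \<comment> \<open>If \<open>v\<close> lacked \<open>\<alpha>\<close>, adding it would give a
      derivable premise by maximality. The rule restores \<open>v\<close> and splits off the modal
      formula as a component contained in \<open>w\<close>.\<close>
    have all_left: "\<alpha> |\<in>| antecedent v" if v: "v \<in> W" and "\<^bold>\<box> \<alpha> |\<in>| \<Gamma> \<or> \<^bold>\<not> \<^bold>\<box> \<alpha> |\<in>| \<Delta>" for v \<alpha>
    proof (rule ccontr)
      assume notin: "\<alpha> |\<notin>| antecedent v"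
      obtain \<Sigma> \<Pi> where v_eq: "v = (\<Sigma> \<Rrightarrow> \<Pi>)" by (cases v)
      have vF: "fset \<Sigma> \<subseteq> F" "fset \<Pi> \<subseteq> F" using WF[OF v] by (simp_all add: v_eq)
      have "\<alpha> \<in> F" using that(2) F closedD by blast
      then have prem: "D ({#finsert \<alpha> \<Sigma> \<Rrightarrow> \<Pi>#} + G)"
        using maximal_premise_left v notin by (simp add: v_eq W_def)
      from that(2) show False
      proof
        assume c: "\<^bold>\<box> \<alpha> |\<in>| \<Gamma>"
        then have "\<^bold>\<box> \<alpha> \<in> F" using F by auto
        then have "D ({#{|\<^bold>\<box> \<alpha>|} \<Rrightarrow> {||}, v#} + G)"
          using rule1[OF HTS5.Box_left prem] vF GF by (simp add: v_eq add_mset_commute)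
        then show False by (rule inW[OF w v, rotated]) (use c in \<open>simp add: w_eq\<close>)
      next
        assume c: "\<^bold>\<not> \<^bold>\<box> \<alpha> |\<in>| \<Delta>"
        then have "\<^bold>\<not> \<^bold>\<box> \<alpha> \<in> F" using F by auto
        then have "D ({#{||} \<Rrightarrow> {|\<^bold>\<not> \<^bold>\<box> \<alpha>|}, v#} + G)"
          using rule1[OF HTS5.Neg_Box_S5_right prem] vF GF by (simp add: v_eq add_mset_commute)
        then show False by (rule inW[OF w v, rotated]) (use c in \<open>simp add: w_eq\<close>)
      qed
    qed
    have all_right: "\<alpha> |\<in>| succedent v" if v: "v \<in> W" and "\<^bold>\<diamond> \<alpha> |\<in>| \<Delta> \<or> \<^bold>\<not> \<^bold>\<diamond> \<alpha> |\<in>| \<Gamma>" for v \<alpha>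
    proof (rule ccontr)
      assume notin: "\<alpha> |\<notin>| succedent v"
      obtain \<Sigma> \<Pi> where v_eq: "v = (\<Sigma> \<Rrightarrow> \<Pi>)" by (cases v)
      have vF: "fset \<Sigma> \<subseteq> F" "fset \<Pi> \<subseteq> F" using WF[OF v] by (simp_all add: v_eq)
      have "\<alpha> \<in> F" using that(2) F closedD by blast
      then have prem: "D ({#\<Sigma> \<Rrightarrow> finsert \<alpha> \<Pi>#} + G)"
        using maximal_premise_right v notin by (simp add: v_eq W_def)
      from that(2) show False
      proof
        assume c: "\<^bold>\<diamond> \<alpha> |\<in>| \<Delta>"
        then have "\<^bold>\<diamond> \<alpha> \<in> F" using F by auto
        then have "D ({#{||} \<Rrightarrow> {|\<^bold>\<diamond> \<alpha>|}, v#} + G)"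
          using rule1[OF HTS5.Dia_right prem] vF GF by (simp add: v_eq add_mset_commute)
        then show False by (rule inW[OF w v, rotated]) (use c in \<open>simp add: w_eq\<close>)
      next
        assume c: "\<^bold>\<not> \<^bold>\<diamond> \<alpha> |\<in>| \<Gamma>"
        then have "\<^bold>\<not> \<^bold>\<diamond> \<alpha> \<in> F" using F by auto
        then have "D ({#{|\<^bold>\<not> \<^bold>\<diamond> \<alpha>|} \<Rrightarrow> {||}, v#} + G)"
          using rule1[OF HTS5.Neg_Dia_S5_left prem] vF GF by (simp add: v_eq add_mset_commute)
        then show False by (rule inW[OF w v, rotated]) (use c in \<open>simp add: w_eq\<close>)
      qed
    qed
    show ?thesis
      unfolding modal_saturated_def w_eq antecedent.simps succedent.simps
      using ex_right ex_left all_left all_right by blast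
  qed
  have "\<exists>w\<in>W. \<not> holds_seq (\<lambda>_ v. v \<in> W) canonical_val w S" if "S \<in># H" for S
  proof -
    obtain w where "w \<in> W" "extends S w" using above HX \<open>S \<in># H\<close> by blast
    then show ?thesis using canonical_refutes[of W "\<lambda>_ v. v \<in> W" w S] sat modal by blast
  qed
  then show ?thesis using that by blast
qed

end

lemma HTS5_complete:
  assumes "finite F" "\<And>\<phi>. \<phi> \<in> F \<Longrightarrow> subformulas \<phi> \<subseteq> F" "hypersequent_formulas H \<subseteq> F" "provable HTS5 H"
  shows "deriv hypersequent_formulas HTS5 F H"
proof (rule ccontr)
  assume nD: "\<not> ?thesis"
  have valid: "\<exists>S\<in>#H. \<forall>w\<in>W. holds_seq (\<lambda>_ v. v \<in> W) V w S" for W :: "sequent set" and V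
    using assms(4) by (rule provable_sound) (auto intro: HTS5_sound)
  \<comment> \<open>With \<open>F\<close> empty, \<open>H\<close> has at most empty sequents as
    components. These fail at every world, and \<open>UNIV\<close> is inhabited, so \<open>H\<close>
    would not be valid.\<close>
  have "F \<noteq> {}"
  proof
    assume "F = {}"
    then have "S = ({||} \<Rrightarrow> {||})" if "S \<in># H" for S
      using that assms(3) by (cases S) (fastforce simp: hypersequent_formulas_def)
    then show False using valid[of UNIV] by force
  qed
  then interpret HTS5_analytic F by unfold_locales (use assms in auto)
  obtain W where "\<And>S. S \<in># H \<Longrightarrow> \<exists>w\<in>W. \<not> holds_seq (\<lambda>_ v. v \<in> W) canonical_val w S"
    using countermodel[OF assms(3) nD] by blast
  then show False using valid by blast
qed

theorem theorem5p5:
  shows "subformula_property sequent_formulas gTK \<and>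
    subformula_property sequent_formulas gTKT \<and>
    subformula_property hypersequent_formulas HTS5"
  by (intro conjI subformula_propertyI finite_sequent_formulas finite_hypersequent_formulas
      gTK_complete gTKT_complete HTS5_complete)

end
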